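(* Let $F:\mathbb{R}^n\rightrightarrows\mathbb{R}^n$ be a multifunction satisfying (F1)-(F3) of the context, with bilateral minimal time function $T$ and Hamiltonian $h$. Let $(\alpha,\beta)\in\mathbb{R}^n\times\mathbb{R}^n$ be such that $0<r:=T(\alpha,\beta)<\infty$. If $(\zeta,\theta)\in\widehat{N}_{\mathcal{R}(r)}(\alpha,\beta)$, then $h(\alpha,\zeta)=h(\beta,-\theta)\le 0$.
   Context: $\|\cdot\|$ and $\langle\cdot,\cdot\rangle$ denote the Euclidean norm and inner product (also on product spaces), and $\bar B$ the closed unit ball of $\mathbb{R}^n$. Assumptions on $F:\mathbb{R}^n\rightrightarrows\mathbb{R}^n$: (F1) $F(x)$ is nonempty, compact and convex for every $x\in\mathbb{R}^n$. (F2) $F$ is locally Lipschitz: for every compact set $K\subset\mathbb{R}^n$ there is a constant $L=L(K)$ such that $F(x)\subset F(y)+L\|y-x\|\bar B$ for all $x,y\in K$. (F3) There are positive constants $\gamma,c$ such that for all $x\in\mathbb{R}^n$, $v\in F(x)$ implies $\|v\|\le\gamma\|x\|+c$. A trajectory of $F$ is an absolutely continuous function $x(\cdot)$ with $\dot x(t)\in F(x(t))$ for a.e. $t$ in its interval of definition. The bilateral minimal time function $T:\mathbb{R}^n\times\mathbb{R}^n\to[0,+\infty]$ is $T(\alpha,\beta)=\inf\{\tau\ge 0:\text{ there is a trajectory }x(\cdot)\text{ of }F\text{ on }[0,\tau]\text{ with }x(0)=\alpha,\ x(\tau)=\beta\}$, with $T(\alpha,\beta)=+\infty$ if there is no such trajectory.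 The Hamiltonian is $h(x,p)=\min_{v\in F(x)}\langle v,p\rangle$ for $(x,p)\in\mathbb{R}^n\times\mathbb{R}^n$. For $t>0$, $\mathcal{R}(t)=\{(x,y)\in\mathbb{R}^n\times\mathbb{R}^n: T(x,y)\le t\}$. For a closed set $S\subset\mathbb{R}^m$ and $x\in S$, the Fréchet normal cone $\widehat{N}_S(x)$ is the set of $\zeta\in\mathbb{R}^m$ with $\limsup_{S\ni y\to x}\frac{\langle\zeta,y-x\rangle}{\|y-x\|}\le 0$, i.e. for every $\varepsilon>0$ there is $\delta>0$ with $\langle\zeta,y-x\rangle\le\varepsilon\|y-x\|$ for all $y\in S$ with $\|y-x\|<\delta$. *)

theory Defs
  imports "HOL-Analysis.Analysis"
begin

text \<open>
  Absolute continuity of a function on a real interval. The elements of \<open>D\<close> are finitely many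
  pairwise nonoverlapping compact intervals \<open>[Inf k, Sup k]\<close> contained in \<open>I\<close>; the library constant
  \<open>absolutely_continuous\<close> is the unrelated notion for measures.
\<close>

definition abs_continuous_on :: "real set \<Rightarrow> (real \<Rightarrow> 'a::real_normed_vector) \<Rightarrow> bool" where
  "abs_continuous_on I f \<longleftrightarrow>
     (\<forall>\<epsilon>>0. \<exists>\<delta>>0. \<forall>D. D division_of \<Union>D \<and> \<Union>D \<subseteq> I \<and> (\<Sum>k\<in>D. Sup k - Inf k) < \<delta>
        \<longrightarrow> (\<Sum>k\<in>D. norm (f (Sup k) - f (Inf k))) < \<epsilon>)"

definition locally_Lipschitz_multi ::
    "('a::euclidean_space \<Rightarrow> 'a set) \<Rightarrow> bool" where
  "locally_Lipschitz_multi F \<longleftrightarrow>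
     (\<forall>K. compact K \<longrightarrow>
        (\<exists>L. \<forall>x\<in>K. \<forall>y\<in>K. F x \<subseteq> {w + (L * norm (y - x)) *\<^sub>R b | w b. w \<in> F y \<and> b \<in> cball 0 1}))"

definition linear_growth_multi :: "('a::euclidean_space \<Rightarrow> 'a set) \<Rightarrow> bool" where
  "linear_growth_multi F \<longleftrightarrow>
     (\<exists>\<gamma>>0. \<exists>c>0. \<forall>x. \<forall>v\<in>F x. norm v \<le> \<gamma> * norm x + c)"

definition trajectory_on :: "('a::euclidean_space \<Rightarrow> 'a set) \<Rightarrow> real \<Rightarrow> (real \<Rightarrow> 'a) \<Rightarrow> bool" where
  "trajectory_on F \<tau> x \<longleftrightarrow>
     abs_continuous_on {0..\<tau>} x \<and>
     (AE t in lebesgue. t \<in> {0..\<tau>} \<longrightarrow>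
        (\<exists>v\<in>F (x t). (x has_vector_derivative v) (at t within {0..\<tau>})))"

text \<open>In \<^typ>\<open>ereal\<close> the infimum of the empty set is \<open>\<infinity>\<close>.\<close>

definition bilateral_min_time :: "('a::euclidean_space \<Rightarrow> 'a set) \<Rightarrow> 'a \<Rightarrow> 'a \<Rightarrow> ereal" where
  "bilateral_min_time F \<alpha> \<beta> =
     Inf {ereal \<tau> | \<tau>. 0 \<le> \<tau> \<and> (\<exists>x. trajectory_on F \<tau> x \<and> x 0 = \<alpha> \<and> x \<tau> = \<beta>)}"

text \<open>
  The minimum of \<open>\<langle>v, p\<rangle>\<close> over \<open>v \<in> F x\<close>, meaningful when it is attained, e.g. when \<open>F x\<close> is
  nonempty and compact.
\<close>

definition hamiltonian :: "('a::euclidean_space \<Rightarrow> 'a set) \<Rightarrow> 'a \<Rightarrow> 'a \<Rightarrow> real" where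
  "hamiltonian F x p = (LEAST m. m \<in> (\<lambda>v. v \<bullet> p) ` F x)"

definition min_time_sublevel :: "('a::euclidean_space \<Rightarrow> 'a set) \<Rightarrow> real \<Rightarrow> ('a \<times> 'a) set" where
  "min_time_sublevel F t = {(x, y). bilateral_min_time F x y \<le> ereal t}"

definition frechet_normal_cone :: "'b::euclidean_space set \<Rightarrow> 'b \<Rightarrow> 'b set" where
  "frechet_normal_cone S x =
     {\<zeta>. \<forall>\<epsilon>>0. \<exists>\<delta>>0. \<forall>y\<in>S. norm (y - x) < \<delta> \<longrightarrow> \<zeta> \<bullet> (y - x) \<le> \<epsilon> * norm (y - x)}"

end

theory Submission
  imports Defs "HOL-Complex_Analysis.Great_Picard"
begin

text \<open>
  Let \<open>x\<close> be an almost optimal trajectory from \<open>\<alpha>\<close> to \<open>\<beta>\<close>, and let \<open>y\<close> be a trajectory that starts in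
  \<open>\<beta>\<close> with velocity \<open>v \<in> F \<beta>\<close>. Dropping the piece of \<open>x\<close> on \<open>[0, t]\<close> and appending a piece of \<open>y\<close> of
  almost the same length shows that \<open>(x t, y s)\<close> lies in the sublevel set for some \<open>s = t + o(t)\<close>.
  Since \<open>(x t - \<alpha>) / t\<close> is close to \<open>F \<alpha>\<close> uniformly in \<open>x\<close>, normality yields
  \<open>h(\<alpha>, \<zeta>) + \<langle>v, \<theta>\<rangle> \<le> 0\<close> as \<open>t\<close> tends to \<open>0\<close>. Minimising over \<open>v\<close> gives \<open>h(\<alpha>, \<zeta>) \<le> h(\<beta>, -\<theta>)\<close>, while
  staying at \<open>\<beta>\<close> gives \<open>h(\<alpha>, \<zeta>) \<le> 0\<close>. Time reversal, which replaces \<open>F\<close> by \<open>-F\<close> and swaps the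
  endpoints, gives the opposite inequality.
\<close>

subsection \<open>Absolutely continuous functions\<close>

lemma abs_continuous_onE:
  assumes "abs_continuous_on I f" "e > 0"
  obtains d where "d > 0"
    "\<forall>D. D division_of \<Union>D \<and> \<Union>D \<subseteq> I \<and> (\<Sum>k\<in>D. Sup k - Inf k) < d
      \<longrightarrow> (\<Sum>k\<in>D. norm (f (Sup k) - f (Inf k))) < e"
  using assms unfolding abs_continuous_on_def by blast

lemma abs_continuous_on_subset:
  assumes "abs_continuous_on I f" "J \<subseteq> I"
  shows "abs_continuous_on J f"
  unfolding abs_continuous_on_def
proof (intro allI impI)
  fix e :: real assume "e > 0"
  obtain d where "d > 0"
    and "\<forall>D. D division_of \<Union>D \<and> \<Union>D \<subseteq> I \<and> (\<Sum>k\<in>D. Sup k - Inf k) < d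
        \<longrightarrow> (\<Sum>k\<in>D. norm (f (Sup k) - f (Inf k))) < e"
    using abs_continuous_onE[OF assms(1) \<open>e > 0\<close>] .
  with assms(2)
  show "\<exists>d>0. \<forall>D. D division_of \<Union>D \<and> \<Union>D \<subseteq> J \<and> (\<Sum>k\<in>D. Sup k - Inf k) < d
        \<longrightarrow> (\<Sum>k\<in>D. norm (f (Sup k) - f (Inf k))) < e"
    by (meson subset_trans)
qed

lemma division_of_real_mem:
  fixes D :: "real set set"
  assumes "D division_of S" "k \<in> D"
  shows "Inf k \<le> Sup k" "k = {Inf k..Sup k}" "Inf k \<in> k" "Sup k \<in> k"
proof -
  obtain a b where k: "k = cbox a b" and "k \<noteq> {}"
    using division_ofD(3,4)[OF assms] by blast
  then have "a \<le> b" by auto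
  with k show "Inf k \<le> Sup k" "k = {Inf k..Sup k}" "Inf k \<in> k" "Sup k \<in> k"
    by auto
qed

text \<open>Over each interval of a division the increment of \<open>g\<close> is controlled by that
  of \<open>f\<close>. Domination by the identity yields Lipschitz functions; domination by a curve
  yields its inner products with a fixed vector.\<close>

lemma abs_continuous_on_dominated:
  assumes ac: "abs_continuous_on I f"
    and g: "\<And>s t. s \<in> I \<Longrightarrow> t \<in> I \<Longrightarrow> norm (g s - g t) \<le> C * norm (f s - f t)"
  shows "abs_continuous_on I g"
  unfolding abs_continuous_on_def
proof (intro allI impI)
  fix e :: real assume "e > 0"
  \<comment> \<open>\<open>C\<close> may be zero or negative, whereas \<open>c\<close> is positive
    and exceeds it, so that the tolerance \<open>e / c\<close> makes sense.\<close>
  define c where "c = \<bar>C\<bar> + 1"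
  have "c > 0" by (simp add: c_def)
  have "e / c > 0" using \<open>e > 0\<close> \<open>c > 0\<close> by simp
  obtain d where "d > 0"
    and d: "\<forall>D. D division_of \<Union>D \<and> \<Union>D \<subseteq> I \<and> (\<Sum>k\<in>D. Sup k - Inf k) < d
        \<longrightarrow> (\<Sum>k\<in>D. norm (f (Sup k) - f (Inf k))) < e / c"
    using abs_continuous_onE[OF ac \<open>e / c > 0\<close>] .
  have "(\<Sum>k\<in>D. norm (g (Sup k) - g (Inf k))) < e"
    if D: "D division_of \<Union>D \<and> \<Union>D \<subseteq> I \<and> (\<Sum>k\<in>D. Sup k - Inf k) < d" for D
  proof -
    have "norm (g (Sup k) - g (Inf k)) \<le> c * norm (f (Sup k) - f (Inf k))" if "k \<in> D" for k
    proof -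
      have "Sup k \<in> I" "Inf k \<in> I"
        using D that division_of_real_mem(3,4)[of D "\<Union>D" k] by auto
      then have "norm (g (Sup k) - g (Inf k)) \<le> C * norm (f (Sup k) - f (Inf k))"
        by (rule g)
      also have "\<dots> \<le> c * norm (f (Sup k) - f (Inf k))"
        by (rule mult_right_mono) (auto simp: c_def)
      finally show ?thesis .
    qed
    then have "(\<Sum>k\<in>D. norm (g (Sup k) - g (Inf k))) \<le> c * (\<Sum>k\<in>D. norm (f (Sup k) - f (Inf k)))"
      by (simp add: sum_distrib_left sum_mono)
    also have "\<dots> < c * (e / c)"
      using d[rule_format, OF D] \<open>c > 0\<close> by (intro mult_strict_left_mono) auto
    finally show ?thesis using \<open>c > 0\<close> by simp
  qed
  with \<open>d > 0\<close>
  show "\<exists>d>0. \<forall>D. D division_of \<Union>D \<and> \<Union>D \<subseteq> I \<and> (\<Sum>k\<in>D. Sup k - Inf k) < d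
        \<longrightarrow> (\<Sum>k\<in>D. norm (g (Sup k) - g (Inf k))) < e"
    by (intro exI[of _ d]) simp
qed

lemma abs_continuous_on_id: "abs_continuous_on I (\<lambda>t. t)"
  unfolding abs_continuous_on_def
proof (intro allI impI)
  fix e :: real assume "e > 0"
  have "(\<Sum>k\<in>D. norm (Sup k - Inf k)) = (\<Sum>k\<in>D. Sup k - Inf k)"
    if "D division_of \<Union>D" for D :: "real set set"
    by (rule sum.cong) (use division_of_real_mem(1)[OF that] in auto)
  with \<open>e > 0\<close>
  show "\<exists>d>0. \<forall>D. D division_of \<Union>D \<and> \<Union>D \<subseteq> I \<and> (\<Sum>k\<in>D. Sup k - Inf k) < d
        \<longrightarrow> (\<Sum>k\<in>D. norm (Sup k - Inf k)) < e"
    by (intro exI[of _ e]) auto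
qed

lemma lipschitz_on_imp_abs_continuous_on:
  assumes "M-lipschitz_on I f"
  shows "abs_continuous_on I f"
  by (rule abs_continuous_on_dominated[OF abs_continuous_on_id])
    (use lipschitz_on_normD[OF assms] in simp)

lemma abs_continuous_on_imp_continuous_on:
  assumes ac: "abs_continuous_on {a..b} f"
  shows "continuous_on {a..b} f"
  unfolding continuous_on_iff
proof (intro ballI allI impI)
  fix t and e :: real assume t: "t \<in> {a..b}" and "e > 0"
  obtain d where "d > 0"
    and d: "\<forall>D. D division_of \<Union>D \<and> \<Union>D \<subseteq> {a..b} \<and> (\<Sum>k\<in>D. Sup k - Inf k) < d
        \<longrightarrow> (\<Sum>k\<in>D. norm (f (Sup k) - f (Inf k))) < e"
    using abs_continuous_onE[OF ac \<open>e > 0\<close>] .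
  have *: "norm (f v - f u) < e" if "a \<le> u" "u \<le> v" "v \<le> b" "v - u < d" for u v
  proof -
    have "{{u..v}} division_of {u..v}"
      using division_of_self[of u v] that by (simp add: box_real)
    then show ?thesis
      using d[rule_format, of "{{u..v}}"] that by simp
  qed
  have "dist (f s) (f t) < e" if "s \<in> {a..b}" "dist s t < d" for s
    using *[of s t] *[of t s] that t
    by (cases "s \<le> t") (auto simp: dist_norm norm_minus_commute)
  with \<open>d > 0\<close> show "\<exists>d>0. \<forall>s\<in>{a..b}. dist s t < d \<longrightarrow> dist (f s) (f t) < e"
    by blast
qed

section \<open>Mean value inequalities with an exceptional null set\<close>

lemma negligible_outer_open:
  fixes N :: "'a::euclidean_space set"
  assumes "negligible N" "e > 0"
  obtains U where "open U" "N \<subseteq> U" "U \<in> lmeasurable" "measure lebesgue U < e"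
proof -
  have N: "N \<in> null_sets lebesgue" "N \<in> sets lebesgue"
    using assms(1) by (auto simp: negligible_iff_null_sets)
  obtain U where U: "open U" "N \<subseteq> U" "U - N \<in> lmeasurable" "emeasure lebesgue (U - N) < ennreal e"
    using sets_lebesgue_outer_open[OF N(2) assms(2)] by blast
  have "U \<in> sets lebesgue"
    using U(1) by (metis borel_open sets_completionI_sets sets_lborel)
  then have "emeasure lebesgue U = emeasure lebesgue (U - N)"
    using N(1) by (simp add: emeasure_Diff_null_set)
  with U(4) have less: "emeasure lebesgue U < ennreal e" by simp
  then have "U \<in> lmeasurable"
    using \<open>U \<in> sets lebesgue\<close>
    using order.strict_trans[OF less ennreal_less_top] by (simp add: fmeasurableI)
  moreover from this less have "measure lebesgue U < e"
    by (metis emeasure_eq_measure2 ennreal_leI not_le)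
  ultimately show thesis using that U(1,2) by blast
qed

lemma sum_tagged_partial_division_snd:
  fixes \<phi> :: "real \<Rightarrow> real \<Rightarrow> 'b::comm_monoid_add"
  assumes q: "q tagged_partial_division_of S" and \<phi>: "\<And>u. \<phi> u u = 0"
  shows "(\<Sum>(t,k)\<in>q. \<phi> (Inf k) (Sup k)) = (\<Sum>k\<in>snd ` q. \<phi> (Inf k) (Sup k))"
proof -
  have "(\<Sum>k\<in>snd ` q. \<phi> (Inf k) (Sup k)) = (\<Sum>z\<in>q. \<phi> (Inf (snd z)) (Sup (snd z)))"
  proof (subst sum.reindex_nontrivial)
    show "finite q" using q by (rule tagged_partial_division_ofD)
    fix y z assume yz: "y \<in> q" "z \<in> q" "y \<noteq> z" "snd y = snd z"
    obtain t k where y: "y = (t, k)" by fastforce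
    obtain s where z: "z = (s, k)" using y yz by (metis snd_conv surj_pair)
    have "interior k \<inter> interior k = {}"
      using tagged_partial_division_ofD(5)[OF q, of t k s k] yz y z by auto
    moreover obtain u v where k: "k = cbox u v"
      using tagged_partial_division_ofD(4)[OF q, of t k] yz(1) y by auto
    moreover have "t \<in> k"
      using tagged_partial_division_ofD(2)[OF q, of t k] yz(1) y by auto
    ultimately have "u = v" by (auto simp: box_real)
    then show "\<phi> (Inf (snd y)) (Sup (snd y)) = 0"
      using \<phi> y k by simp
  qed (simp add: o_def)
  then show ?thesis by (simp add: case_prod_beta)
qed

text \<open>In a fine tagged division, the intervals tagged in the exceptional null set lie in an open
  set of small measure, so that absolute continuity makes their contribution negligible.\<close>

lemma abs_continuous_on_increment_ge:
  fixes g :: "real \<Rightarrow> real"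
  assumes ac: "abs_continuous_on {a..b} g" and "a \<le> b" and N: "negligible N"
    and deriv: "\<And>t. t \<in> {a..b} - N \<Longrightarrow>
      \<exists>d\<ge>m. (g has_vector_derivative d) (at t within {a..b})"
  shows "m * (b - a) \<le> g b - g a"
proof -
  have main: "(m - e) * (b - a) - 2 * e \<le> g b - g a" if "e > 0" for e
  proof -
    obtain d where "d > 0"
      and d: "\<forall>D. D division_of \<Union>D \<and> \<Union>D \<subseteq> {a..b} \<and> (\<Sum>k\<in>D. Sup k - Inf k) < d
          \<longrightarrow> (\<Sum>k\<in>D. norm (g (Sup k) - g (Inf k))) < e"
      using abs_continuous_onE[OF ac \<open>e > 0\<close>] .
    \<comment> \<open>The first bound makes absolute continuity applicable to the badly tagged
      intervals; the second keeps \<bar>m\<bar> times their total length below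
      \<open>e\<close>.\<close>
    define d' where "d' = min d (e / (\<bar>m\<bar> + 1))"
    have "d' > 0" using \<open>d > 0\<close> \<open>e > 0\<close> by (simp add: d'_def)
    then obtain U where U: "open U" "N \<subseteq> U" "U \<in> lmeasurable" "measure lebesgue U < d'"
      using negligible_outer_open N by blast
    \<comment> \<open>The gauge: at a good tag a ball on which the straddle estimate for the
      derivative holds, at an exceptional tag the small open set \<open>U\<close>, and elsewhere no
      restriction.\<close>
    have "\<exists>G. open G \<and> t \<in> G \<and> (t \<in> N \<longrightarrow> G \<subseteq> U) \<and>
        (t \<in> {a..b} - N \<longrightarrow> (\<forall>u v. {u..v} \<subseteq> G \<inter> {a..b} \<longrightarrow> t \<in> {u..v} \<longrightarrow>
           (m - e) * (v - u) \<le> g v - g u))" for t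
    proof (cases "t \<in> {a..b} - N")
      case True
      then obtain c where "c \<ge> m" and c: "(g has_vector_derivative c) (at t within {a..b})"
        using deriv by blast
      obtain r where "r > 0"
        and r: "\<And>y. y \<in> {a..b} \<Longrightarrow> norm (y - t) < r \<Longrightarrow>
            norm (g y - g t - (y - t) *\<^sub>R c) \<le> e * norm (y - t)"
        using c \<open>e > 0\<close> unfolding has_vector_derivative_def has_derivative_within_alt by metis
      have "(m - e) * (v - u) \<le> g v - g u"
        if "{u..v} \<subseteq> ball t r \<inter> {a..b}" "t \<in> {u..v}" for u v
      proof -
        have "u \<le> t" "t \<le> v" "u \<in> {u..v}" "v \<in> {u..v}" using that(2) by auto
        with that(1) have uv: "u \<in> ball t r \<inter> {a..b}" "v \<in> ball t r \<inter> {a..b}" "u \<le> t" "t \<le> v"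
          by blast+
        then have "\<bar>g u - g t - (u - t) * c\<bar> \<le> e * (t - u)"
          "\<bar>g v - g t - (v - t) * c\<bar> \<le> e * (v - t)"
          using r[of u] r[of v] by (auto simp: dist_real_def)
        then have "c * (v - u) - e * (v - u) \<le> g v - g u"
          by (simp add: algebra_simps abs_le_iff)
        moreover have "m * (v - u) \<le> c * (v - u)"
          using \<open>c \<ge> m\<close> uv by (intro mult_right_mono) auto
        ultimately show ?thesis by (simp add: algebra_simps)
      qed
      then show ?thesis
        using True \<open>r > 0\<close> by (intro exI[of _ "ball t r"]) auto
    next
      case False
      then show ?thesis
        using U(1,2) by (intro exI[of _ "if t \<in> N then U else UNIV"]) auto
    qed
    then obtain G where G: "\<And>t. open (G t)" "\<And>t. t \<in> G t" "\<And>t. t \<in> N \<Longrightarrow> G t \<subseteq> U"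
      and G': "\<And>t u v. t \<in> {a..b} - N \<Longrightarrow> {u..v} \<subseteq> G t \<inter> {a..b} \<Longrightarrow> t \<in> {u..v} \<Longrightarrow>
           (m - e) * (v - u) \<le> g v - g u"
      by metis
    have "gauge G" using G by (simp add: gauge_def)
    then obtain p where p: "p tagged_division_of {a..b}" "G fine p"
      using fine_division_exists_real by blast
    have pp: "p tagged_partial_division_of {a..b}"
      using p(1) by (simp add: tagged_division_of_def)
    define q where "q = {z \<in> p. fst z \<in> N}"
    have q: "q tagged_partial_division_of {a..b}"
      by (rule tagged_partial_division_subset[OF pp]) (auto simp: q_def)
    have "finite p" using pp by (rule tagged_partial_division_ofD)
    define D where "D = snd ` q"
    have D: "D division_of \<Union>D"
      unfolding D_def using q by (rule partial_division_of_tagged_division)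
    have Dsub: "\<Union>D \<subseteq> {a..b}" "\<Union>D \<subseteq> U"
      using tagged_partial_division_ofD(3)[OF q] p(2) G(3)
      by (fastforce simp: D_def q_def fine_def)+
    \<comment> \<open>The badly tagged intervals do not overlap and lie in \<open>U\<close>, so
      their total length is at most the measure of \<open>U\<close>.\<close>
    have "(\<Sum>k\<in>D. Sup k - Inf k) = (\<Sum>k\<in>D. measure lebesgue k)"
    proof (rule sum.cong)
      fix k assume "k \<in> D"
      note k = division_of_real_mem[OF D this]
      have "measure lebesgue {Inf k..Sup k} = Sup k - Inf k" using k(1) by simp
      then show "Sup k - Inf k = measure lebesgue k" using k(2) by simp
    qed simp
    also have "\<dots> = measure lebesgue (\<Union>D)"
      using content_division[OF D] by simp
    also have "\<dots> \<le> measure lebesgue U"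
      using Dsub(2) U(3) lmeasurable_division[OF D]
      by (intro measure_mono_fmeasurable) (auto simp: fmeasurableD)
    also have "\<dots> < d'" by (rule U)
    finally have len: "(\<Sum>k\<in>D. Sup k - Inf k) < d'" .
    have var: "(\<Sum>k\<in>D. norm (g (Sup k) - g (Inf k))) < e"
      by (rule d[rule_format]) (use D Dsub len in \<open>auto simp: d'_def\<close>)
    have "(\<Sum>(t,k)\<in>q. norm (g (Sup k) - g (Inf k)) + \<bar>m\<bar> * (Sup k - Inf k))
        = (\<Sum>k\<in>D. norm (g (Sup k) - g (Inf k)) + \<bar>m\<bar> * (Sup k - Inf k))"
      unfolding D_def
      by (rule sum_tagged_partial_division_snd[OF q, of "\<lambda>u v. norm (g v - g u) + \<bar>m\<bar> * (v - u)"]) simp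
    also have "\<dots> = (\<Sum>k\<in>D. norm (g (Sup k) - g (Inf k))) + \<bar>m\<bar> * (\<Sum>k\<in>D. Sup k - Inf k)"
      by (simp add: sum.distrib sum_distrib_left)
    also have "\<dots> \<le> e + e"
    proof (rule add_mono)
      have "\<bar>m\<bar> * (\<Sum>k\<in>D. Sup k - Inf k) \<le> (\<bar>m\<bar> + 1) * (e / (\<bar>m\<bar> + 1))"
        using len D division_of_real_mem(1)[OF D]
        by (intro mult_mono) (auto simp: d'_def intro!: sum_nonneg)
      then show "\<bar>m\<bar> * (\<Sum>k\<in>D. Sup k - Inf k) \<le> e" by simp
    qed (use var in simp)
    finally have bad: "(\<Sum>(t,k)\<in>q. norm (g (Sup k) - g (Inf k)) + \<bar>m\<bar> * (Sup k - Inf k)) \<le> 2 * e"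
      by simp
    have q_p: "(\<Sum>(t,k)\<in>q. norm (g (Sup k) - g (Inf k)) + \<bar>m\<bar> * (Sup k - Inf k)) =
        (\<Sum>(t,k)\<in>p. if t \<in> N then norm (g (Sup k) - g (Inf k)) + \<bar>m\<bar> * (Sup k - Inf k) else 0)"
      unfolding q_def case_prod_beta by (rule sum.inter_filter[OF \<open>finite p\<close>])
    \<comment> \<open>Each summand is nonnegative: at a good tag by the straddle estimate, at a bad
      tag because the added penalty outweighs both the increment of \<open>g\<close> and the linear
      term. The first two sums then telescope, and the penalties add up to at most
      \<open>2 * e\<close>.\<close>
    have "0 \<le> (\<Sum>(t,k)\<in>p. (g (Sup k) - g (Inf k)) - (m - e) * (Sup k - Inf k)
          + (if t \<in> N then norm (g (Sup k) - g (Inf k)) + \<bar>m\<bar> * (Sup k - Inf k) else 0))"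
    proof (rule sum_nonneg, clarify)
      fix t k assume tk: "(t, k) \<in> p"
      obtain u v where k: "k = cbox u v"
        using tagged_partial_division_ofD(4)[OF pp tk] by auto
      have tk': "t \<in> k" "k \<subseteq> {a..b}" "k \<subseteq> G t"
        using tagged_partial_division_ofD(2,3)[OF pp tk] p(2) tk by (auto simp: fine_def)
      then have uv: "Inf k = u" "Sup k = v" "u \<le> v" using k by auto
      show "0 \<le> (g (Sup k) - g (Inf k)) - (m - e) * (Sup k - Inf k)
          + (if t \<in> N then norm (g (Sup k) - g (Inf k)) + \<bar>m\<bar> * (Sup k - Inf k) else 0)"
      proof (cases "t \<in> N")
        case True
        have "(m - e) * (v - u) \<le> \<bar>m\<bar> * (v - u)"
          using uv \<open>e > 0\<close> by (intro mult_right_mono) auto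
        then show ?thesis using True uv by simp
      next
        case False
        then show ?thesis using G'[of t u v] tk' uv k by auto
      qed
    qed
    also have "\<dots> = (\<Sum>(t,k)\<in>p. g (Sup k) - g (Inf k)) - (m - e) * (\<Sum>(t,k)\<in>p. Sup k - Inf k)
        + (\<Sum>(t,k)\<in>q. norm (g (Sup k) - g (Inf k)) + \<bar>m\<bar> * (Sup k - Inf k))"
      unfolding q_p by (simp only: case_prod_unfold sum.distrib sum_subtractf sum_distrib_left[symmetric])
    also have "(\<Sum>(t,k)\<in>p. g (Sup k) - g (Inf k)) = g b - g a"
      by (rule additive_tagged_division_1[OF \<open>a \<le> b\<close> p(1)])
    also have "(\<Sum>(t,k)\<in>p. Sup k - Inf k) = b - a"
      by (rule additive_tagged_division_1[OF \<open>a \<le> b\<close> p(1)])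
    finally show ?thesis using bad by linarith
  qed
  show ?thesis
  proof (rule field_le_epsilon)
    fix e :: real assume "e > 0"
    \<comment> \<open>The total error in \<open>main\<close> is
      \<open>e' * (b - a) + 2 * e'\<close>.\<close>
    define e' where "e' = e / (b - a + 2)"
    have "e' > 0" using \<open>e > 0\<close> \<open>a \<le> b\<close> by (simp add: e'_def)
    have "e' * (b - a + 2) = e" using \<open>a \<le> b\<close> by (simp add: e'_def)
    then show "m * (b - a) \<le> g b - g a + e"
      using main[OF \<open>e' > 0\<close>] by (simp add: algebra_simps)
  qed
qed

text \<open>The scalar inequality applied to the component of \<open>x\<close> along
  \<open>p\<close>. Adding the endpoints to the null set leaves only interior points, where
  two-sided derivatives are available.\<close>

lemma abs_continuous_on_inner_increment_ge:
  fixes x :: "real \<Rightarrow> 'a::euclidean_space"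
  assumes ac: "abs_continuous_on {a..b} x" and "a \<le> b" and N: "negligible N"
    and deriv: "\<And>t. a < t \<Longrightarrow> t < b \<Longrightarrow> t \<notin> N \<Longrightarrow>
      \<exists>v. m \<le> v \<bullet> p \<and> (x has_vector_derivative v) (at t)"
  shows "m * (b - a) \<le> (x b - x a) \<bullet> p"
proof -
  have "m * (b - a) \<le> x b \<bullet> p - x a \<bullet> p"
  proof (rule abs_continuous_on_increment_ge[where g = "\<lambda>t. x t \<bullet> p" and N = "N \<union> {a, b}"])
    show "abs_continuous_on {a..b} (\<lambda>t. x t \<bullet> p)"
    proof (rule abs_continuous_on_dominated[OF ac])
      fix s t
      show "norm (x s \<bullet> p - x t \<bullet> p) \<le> norm p * norm (x s - x t)"
        using Cauchy_Schwarz_ineq2[of "x s - x t" p] by (simp add: inner_diff_left mult.commute)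
    qed
    show "negligible (N \<union> {a, b})"
      using N by (simp add: negligible_Un negligible_finite)
    fix t assume "t \<in> {a..b} - (N \<union> {a, b})"
    then obtain v where v: "m \<le> v \<bullet> p" "(x has_vector_derivative v) (at t)"
      using deriv[of t] by force
    have "((\<lambda>t. x t \<bullet> p) has_vector_derivative v \<bullet> p) (at t within {a..b})"
      by (rule bounded_linear.has_vector_derivative[OF bounded_linear_inner_left
          has_vector_derivative_at_within[OF v(2)]])
    with v(1) show "\<exists>d\<ge>m. ((\<lambda>t. x t \<bullet> p) has_vector_derivative d) (at t within {a..b})"
      by blast
  qed (use \<open>a \<le> b\<close> in simp)
  then show ?thesis by (simp add: inner_diff_left)
qed

text \<open>Testing against minus the displacement bounds its squared norm by
  \<open>M * (b - a)\<close> times its norm. One factor cancels unless the displacement vanishes,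
  which is the separate case.\<close>

lemma abs_continuous_on_norm_increment_le:
  fixes x :: "real \<Rightarrow> 'a::euclidean_space"
  assumes ac: "abs_continuous_on {a..b} x" and "a \<le> b" and N: "negligible N" and "0 \<le> M"
    and deriv: "\<And>t. a < t \<Longrightarrow> t < b \<Longrightarrow> t \<notin> N \<Longrightarrow>
      \<exists>v. norm v \<le> M \<and> (x has_vector_derivative v) (at t)"
  shows "norm (x b - x a) \<le> M * (b - a)"
proof (cases "x b = x a")
  case False
  define w where "w = x b - x a"
  have "(- (M * norm w)) * (b - a) \<le> (x b - x a) \<bullet> (- w)"
  proof (rule abs_continuous_on_inner_increment_ge[OF ac \<open>a \<le> b\<close> N])
    fix t assume "a < t" "t < b" "t \<notin> N"
    then obtain v where v: "norm v \<le> M" "(x has_vector_derivative v) (at t)"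
      using deriv by blast
    have "v \<bullet> w \<le> norm v * norm w" by (rule norm_cauchy_schwarz)
    also have "\<dots> \<le> M * norm w" using v(1) by (simp add: mult_right_mono)
    finally show "\<exists>v. - (M * norm w) \<le> v \<bullet> (- w) \<and> (x has_vector_derivative v) (at t)"
      using v(2) by (intro exI[of _ v]) simp
  qed
  then have "norm w * norm w \<le> norm w * (M * (b - a))"
    by (simp add: w_def[symmetric] power2_norm_eq_inner[symmetric] power2_eq_square mult_ac)
  then show ?thesis using False by (simp add: w_def)
qed (use assms in simp)

subsection \<open>Trajectories\<close>

text \<open>This rule and the elimination rule after it pass between the almost-everywhere
  formulation and a null set off which two-sided derivatives exist at interior times, the form
  suited to gluing and reparametrisation.\<close>

lemma trajectory_onI:
  assumes "M-lipschitz_on {0..\<tau>} x" "negligible N"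
    and "\<And>t. 0 < t \<Longrightarrow> t < \<tau> \<Longrightarrow> t \<notin> N \<Longrightarrow> \<exists>v\<in>F (x t). (x has_vector_derivative v) (at t)"
  shows "trajectory_on F \<tau> x"
  unfolding trajectory_on_def
proof
  show "abs_continuous_on {0..\<tau>} x"
    using assms(1) by (rule lipschitz_on_imp_abs_continuous_on)
  have "negligible (N \<union> {0, \<tau>})"
    using assms(2) by (simp add: negligible_Un negligible_finite)
  moreover have "{t. \<not> (t \<in> {0..\<tau>} \<longrightarrow> (\<exists>v\<in>F (x t). (x has_vector_derivative v) (at t within {0..\<tau>})))}
      \<subseteq> N \<union> {0, \<tau>}"
  proof (clarsimp, rule ccontr)
    fix t assume t: "0 \<le> t" "t \<le> \<tau>" "t \<notin> N" "t \<noteq> \<tau>" "t \<noteq> 0"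
      and no: "\<forall>v\<in>F (x t). \<not> (x has_vector_derivative v) (at t within {0..\<tau>})"
    obtain v where "v \<in> F (x t)" "(x has_vector_derivative v) (at t)"
      using assms(3)[of t] t by auto
    with no show False using has_vector_derivative_at_within by blast
  qed
  ultimately show "AE t in lebesgue. t \<in> {0..\<tau>} \<longrightarrow>
      (\<exists>v\<in>F (x t). (x has_vector_derivative v) (at t within {0..\<tau>}))"
    unfolding eventually_ae_filter_negligible by blast
qed

lemma trajectory_on_derivE:
  assumes "trajectory_on F \<tau> x"
  obtains N where "negligible N"
    "\<And>t. 0 < t \<Longrightarrow> t < \<tau> \<Longrightarrow> t \<notin> N \<Longrightarrow> \<exists>v\<in>F (x t). (x has_vector_derivative v) (at t)"
proof -
  obtain N where N: "negligible N"
    "{t. \<not> (t \<in> {0..\<tau>} \<longrightarrow> (\<exists>v\<in>F (x t). (x has_vector_derivative v) (at t within {0..\<tau>})))} \<subseteq> N"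
    using assms unfolding trajectory_on_def eventually_ae_filter_negligible by blast
  show thesis
  proof (rule that[OF N(1)])
    fix t assume t: "0 < t" "t < \<tau>" "t \<notin> N"
    have "t \<in> {0..\<tau>} \<longrightarrow> (\<exists>v\<in>F (x t). (x has_vector_derivative v) (at t within {0..\<tau>}))"
      using N(2) t(3) by blast
    then obtain v where "v \<in> F (x t)" "(x has_vector_derivative v) (at t within {0..\<tau>})"
      using t by auto
    then show "\<exists>v\<in>F (x t). (x has_vector_derivative v) (at t)"
      using t at_within_Icc_at[of 0 t \<tau>] by auto
  qed
qed

text \<open>The image of a trajectory is compact, so linear growth bounds its speed almost
  everywhere. Lipschitz bounds survive reversal, shifting and gluing directly, without a return to
  divisions.\<close>

lemma trajectory_on_lipschitz:
  assumes x: "trajectory_on F \<tau> x" and growth: "linear_growth_multi F"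
  obtains M where "M-lipschitz_on {0..\<tau>} x"
proof -
  obtain \<gamma> c where \<gamma>: "\<gamma> > 0" "c > 0" and g: "\<And>z v. v \<in> F z \<Longrightarrow> norm v \<le> \<gamma> * norm z + c"
    using growth unfolding linear_growth_multi_def by blast
  have ac: "abs_continuous_on {0..\<tau>} x" using x by (simp add: trajectory_on_def)
  obtain N where N: "negligible N"
    and dN: "\<And>t. 0 < t \<Longrightarrow> t < \<tau> \<Longrightarrow> t \<notin> N \<Longrightarrow> \<exists>v\<in>F (x t). (x has_vector_derivative v) (at t)"
    using trajectory_on_derivE[OF x] by blast
  have "compact (x ` {0..\<tau>})"
    using abs_continuous_on_imp_continuous_on[OF ac] by (simp add: compact_continuous_image)
  then obtain B where "B > 0" and B: "\<And>t. t \<in> {0..\<tau>} \<Longrightarrow> norm (x t) \<le> B"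
    using bounded_pos[of "x ` {0..\<tau>}"] by (auto dest: compact_imp_bounded)
  define M where "M = \<gamma> * B + c"
  have "M \<ge> 0" using \<gamma> \<open>B > 0\<close> by (simp add: M_def)
  have "norm (x t - x s) \<le> M * (t - s)" if st: "0 \<le> s" "s \<le> t" "t \<le> \<tau>" for s t
  proof (rule abs_continuous_on_norm_increment_le[OF _ \<open>s \<le> t\<close> N \<open>M \<ge> 0\<close>])
    show "abs_continuous_on {s..t} x"
      using ac st by (auto intro: abs_continuous_on_subset)
    fix u assume u: "s < u" "u < t" "u \<notin> N"
    then obtain v where v: "v \<in> F (x u)" "(x has_vector_derivative v) (at u)"
      using dN[of u] st by force
    have "norm v \<le> \<gamma> * norm (x u) + c" using g v(1) .
    also have "\<dots> \<le> M"
      using B[of u] u st \<gamma> by (simp add: M_def)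
    finally show "\<exists>v. norm v \<le> M \<and> (x has_vector_derivative v) (at u)"
      using v(2) by blast
  qed
  then have "M-lipschitz_on {0..\<tau>} x"
    using \<open>M \<ge> 0\<close> by (intro lipschitz_on_leI) (auto simp: dist_norm norm_minus_commute)
  then show thesis by (rule that)
qed

section \<open>Reversal, shift and concatenation of trajectories\<close>

lemma negligible_affine_image:
  fixes N :: "real set"
  assumes "negligible N"
  shows "negligible ((\<lambda>t. c * t + d) ` N)"
  by (rule negligible_differentiable_image_negligible[OF _ assms])
    (auto simp: differentiable_on_def intro!: derivative_intros)

lemma trajectory_on_reverse:
  assumes x: "trajectory_on F \<tau> x" and growth: "linear_growth_multi F"
  shows "trajectory_on (\<lambda>z. uminus ` F z) \<tau> (\<lambda>t. x (\<tau> - t))"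
proof -
  obtain M where M: "M-lipschitz_on {0..\<tau>} x"
    using trajectory_on_lipschitz[OF x growth] .
  obtain N where N: "negligible N"
    and dN: "\<And>t. 0 < t \<Longrightarrow> t < \<tau> \<Longrightarrow> t \<notin> N \<Longrightarrow> \<exists>v\<in>F (x t). (x has_vector_derivative v) (at t)"
    using trajectory_on_derivE[OF x] by blast
  show ?thesis
  proof (rule trajectory_onI)
    show "M-lipschitz_on {0..\<tau>} (\<lambda>t. x (\<tau> - t))"
    proof (rule lipschitz_onI)
      fix s t assume "s \<in> {0..\<tau>}" "t \<in> {0..\<tau>}"
      then show "dist (x (\<tau> - s)) (x (\<tau> - t)) \<le> M * dist s t"
        using lipschitz_onD[OF M, of "\<tau> - s" "\<tau> - t"] by (simp add: dist_real_def abs_minus_commute)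
    qed (rule lipschitz_on_nonneg[OF M])
    show "negligible ((\<lambda>t. (-1) * t + \<tau>) ` N)"
      using N by (rule negligible_affine_image)
    fix t assume t: "0 < t" "t < \<tau>" "t \<notin> (\<lambda>t. (-1) * t + \<tau>) ` N"
    have "\<tau> - t \<notin> N"
      using t(3) by (metis (no_types, lifting) add.commute diff_add_cancel image_eqI
          minus_diff_eq mult_minus1 uminus_add_conv_diff)
    then obtain v where v: "v \<in> F (x (\<tau> - t))" "(x has_vector_derivative v) (at (\<tau> - t))"
      using dN[of "\<tau> - t"] t by auto
    have "((x \<circ> (\<lambda>t. \<tau> - t)) has_vector_derivative (-1) *\<^sub>R v) (at t)"
      by (rule vector_diff_chain_at) (use v(2) in \<open>auto intro!: derivative_eq_intros\<close>)
    then have "((\<lambda>t. x (\<tau> - t)) has_vector_derivative - v) (at t)" by (simp add: o_def)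
    then show "\<exists>v\<in>uminus ` F (x (\<tau> - t)). ((\<lambda>t. x (\<tau> - t)) has_vector_derivative v) (at t)"
      using v(1) by blast
  qed
qed

lemma has_vector_derivative_shift:
  assumes "(x has_vector_derivative v) (at (t + c))"
  shows "((\<lambda>u. x (u + c)) has_vector_derivative v) (at t)"
proof -
  have "((x \<circ> (\<lambda>u. u + c)) has_vector_derivative 1 *\<^sub>R v) (at t)"
    by (rule vector_diff_chain_at) (use assms in \<open>auto intro!: derivative_eq_intros\<close>)
  then show ?thesis by (simp add: o_def)
qed

lemma trajectory_on_shift:
  assumes x: "trajectory_on F \<tau> x" and growth: "linear_growth_multi F" and s: "0 \<le> s" "s \<le> \<tau>"
  shows "trajectory_on F (\<tau> - s) (\<lambda>t. x (t + s))"
proof -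
  obtain M where M: "M-lipschitz_on {0..\<tau>} x"
    using trajectory_on_lipschitz[OF x growth] .
  obtain N where N: "negligible N"
    and dN: "\<And>t. 0 < t \<Longrightarrow> t < \<tau> \<Longrightarrow> t \<notin> N \<Longrightarrow> \<exists>v\<in>F (x t). (x has_vector_derivative v) (at t)"
    using trajectory_on_derivE[OF x] by blast
  show ?thesis
  proof (rule trajectory_onI)
    show "M-lipschitz_on {0..\<tau> - s} (\<lambda>t. x (t + s))"
    proof (rule lipschitz_onI)
      fix u v assume "u \<in> {0..\<tau> - s}" "v \<in> {0..\<tau> - s}"
      then show "dist (x (u + s)) (x (v + s)) \<le> M * dist u v"
        using lipschitz_onD[OF M, of "u + s" "v + s"] s by (simp add: dist_real_def)
    qed (rule lipschitz_on_nonneg[OF M])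
    show "negligible ((\<lambda>t. 1 * t + (- s)) ` N)"
      using N by (rule negligible_affine_image)
    fix t assume t: "0 < t" "t < \<tau> - s" "t \<notin> (\<lambda>t. 1 * t + (- s)) ` N"
    have "t + s \<notin> N"
      using t(3) by force
    then show "\<exists>v\<in>F (x (t + s)). ((\<lambda>t. x (t + s)) has_vector_derivative v) (at t)"
      using dN[of "t + s"] t s by (auto intro: has_vector_derivative_shift)
  qed
qed

lemma trajectory_on_concat:
  assumes x: "trajectory_on F \<tau> x" and y: "trajectory_on F \<sigma> y" and growth: "linear_growth_multi F"
    and "0 \<le> \<tau>" "0 \<le> \<sigma>" and xy: "x \<tau> = y 0"
  shows "trajectory_on F (\<tau> + \<sigma>) (\<lambda>t. if t \<le> \<tau> then x t else y (t - \<tau>))"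
proof -
  obtain M where M: "M-lipschitz_on {0..\<tau>} x"
    using trajectory_on_lipschitz[OF x growth] .
  obtain K where K: "K-lipschitz_on {0..\<sigma>} y"
    using trajectory_on_lipschitz[OF y growth] .
  obtain N where N: "negligible N"
    and dN: "\<And>t. 0 < t \<Longrightarrow> t < \<tau> \<Longrightarrow> t \<notin> N \<Longrightarrow> \<exists>v\<in>F (x t). (x has_vector_derivative v) (at t)"
    using trajectory_on_derivE[OF x] by blast
  obtain N' where N': "negligible N'"
    and dN': "\<And>t. 0 < t \<Longrightarrow> t < \<sigma> \<Longrightarrow> t \<notin> N' \<Longrightarrow> \<exists>v\<in>F (y t). (y has_vector_derivative v) (at t)"
    using trajectory_on_derivE[OF y] by blast
  define z where "z = (\<lambda>t. if t \<le> \<tau> then x t else y (t - \<tau>))"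
  have "trajectory_on F (\<tau> + \<sigma>) z"
  proof (rule trajectory_onI)
    have "K-lipschitz_on {\<tau>..\<tau> + \<sigma>} (\<lambda>t. y (t - \<tau>))"
    proof (rule lipschitz_onI)
      fix u v assume "u \<in> {\<tau>..\<tau> + \<sigma>}" "v \<in> {\<tau>..\<tau> + \<sigma>}"
      then show "dist (y (u - \<tau>)) (y (v - \<tau>)) \<le> K * dist u v"
        using lipschitz_onD[OF K, of "u - \<tau>" "v - \<tau>"] by (simp add: dist_real_def)
    qed (rule lipschitz_on_nonneg[OF K])
    then show "(max M K)-lipschitz_on {0..\<tau> + \<sigma>} z"
      unfolding z_def using M xy
      by (intro lipschitz_on_concat) (auto intro: lipschitz_on_le)
    \<comment> \<open>The junction time is exceptional, since the velocities on its two sides may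
      differ.\<close>
    show "negligible (N \<union> (\<lambda>t. 1 * t + \<tau>) ` N' \<union> {\<tau>})"
      using N negligible_affine_image[OF N', of 1 \<tau>] by (simp add: negligible_Un)
    fix t assume t: "0 < t" "t < \<tau> + \<sigma>" "t \<notin> N \<union> (\<lambda>t. 1 * t + \<tau>) ` N' \<union> {\<tau>}"
    show "\<exists>v\<in>F (z t). (z has_vector_derivative v) (at t)"
    proof (cases "t < \<tau>")
      case True
      then obtain v where v: "v \<in> F (x t)" "(x has_vector_derivative v) (at t)"
        using dN[of t] t by auto
      have "(z has_vector_derivative v) (at t)"
        by (rule has_vector_derivative_transform_within_open[OF v(2), of "{..<\<tau>}"])
          (use True in \<open>auto simp: z_def\<close>)
      then show ?thesis using v(1) True by (auto simp: z_def)
    next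
      case False
      with t have "\<tau> < t" by auto
      moreover have "t - \<tau> \<notin> N'" using t(3) by force
      ultimately obtain v where v: "v \<in> F (y (t - \<tau>))" "(y has_vector_derivative v) (at (t + (- \<tau>)))"
        using dN'[of "t - \<tau>"] t by auto
      have "(z has_vector_derivative v) (at t)"
        by (rule has_vector_derivative_transform_within_open
            [OF has_vector_derivative_shift[OF v(2)], of "{\<tau><..}"])
          (use \<open>\<tau> < t\<close> in \<open>auto simp: z_def\<close>)
      then show ?thesis using v(1) \<open>\<tau> < t\<close> by (auto simp: z_def)
    qed
  qed
  then show ?thesis by (simp add: z_def)
qed

lemma trajectory_on_zero: "trajectory_on F 0 x"
  by (rule trajectory_onI[of 0 _ _ "{}"]) (auto intro: lipschitz_onI)

text \<open>\<open>M\<close> bounds the speed inside the unit ball around the starting point. A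
  first exit time \<open>s0 \<le> t\<close> would give
  \<open>1 \<le> M * s0 \<le> M * t < 1\<close>, so the bound persists. It depends on the curve only
  through \<open>x 0\<close>, hence is uniform over all almost optimal trajectories.\<close>

lemma trajectory_on_displacement_le:
  assumes x: "trajectory_on F \<tau> x" and growth: "\<And>z v. v \<in> F z \<Longrightarrow> norm v \<le> \<gamma> * norm z + c"
    and "\<gamma> > 0" "c > 0" and M: "M = \<gamma> * (norm (x 0) + 1) + c"
    and t: "0 \<le> t" "t \<le> \<tau>" "M * t < 1"
  shows "norm (x t - x 0) \<le> M * t"
proof -
  have ac: "abs_continuous_on {0..\<tau>} x" using x by (simp add: trajectory_on_def)
  obtain N where N: "negligible N"
    and dN: "\<And>t. 0 < t \<Longrightarrow> t < \<tau> \<Longrightarrow> t \<notin> N \<Longrightarrow> \<exists>v\<in>F (x t). (x has_vector_derivative v) (at t)"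
    using trajectory_on_derivE[OF x] by blast
  have "M > 0" unfolding M using \<open>\<gamma> > 0\<close> \<open>c > 0\<close> by (intro add_nonneg_pos) auto
  have step: "norm (x s - x 0) \<le> M * s"
    if s: "0 \<le> s" "s \<le> t" and near: "\<And>u. 0 < u \<Longrightarrow> u < s \<Longrightarrow> norm (x u - x 0) < 1" for s
  proof -
    have "norm (x s - x 0) \<le> M * (s - 0)"
    proof (rule abs_continuous_on_norm_increment_le[OF _ \<open>0 \<le> s\<close> N])
      show "abs_continuous_on {0..s} x"
        using ac s t by (auto intro: abs_continuous_on_subset)
      fix u assume u: "0 < u" "u < s" "u \<notin> N"
      then obtain v where v: "v \<in> F (x u)" "(x has_vector_derivative v) (at u)"
        using dN[of u] s t by force
      have "norm (x u) \<le> norm (x 0) + 1"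
        using near[OF u(1,2)] norm_triangle_sub[of "x u" "x 0"] by simp
      then have "\<gamma> * norm (x u) + c \<le> M"
        using \<open>\<gamma> > 0\<close> by (simp add: M)
      with growth[OF v(1)] v(2)
      show "\<exists>v. norm v \<le> M \<and> (x has_vector_derivative v) (at u)" by (meson order_trans)
    qed (use \<open>M > 0\<close> in simp)
    then show ?thesis by simp
  qed
  have near: "norm (x s - x 0) < 1" if "s \<in> {0..t}" for s
  proof (rule ccontr)
    assume far: "\<not> norm (x s - x 0) < 1"
    have cont: "continuous_on {0..t} (\<lambda>s. norm (x s - x 0))"
      using abs_continuous_on_imp_continuous_on[OF ac] t
      by (intro continuous_intros) (auto elim: continuous_on_subset)
    \<comment> \<open>By continuity this set is compact, so if it is nonempty it contains a first
      exit time.\<close>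
    define S where "S = {s \<in> {0..t}. 1 \<le> norm (x s - x 0)}"
    have "compact S"
      unfolding S_def compact_eq_bounded_closed
      using continuous_on_closed_Collect_le[OF continuous_on_const cont]
      by (auto intro: bounded_subset[of "{0..t}"])
    moreover have "S \<noteq> {}" using far that by (auto simp: S_def)
    ultimately obtain s0 where s0: "s0 \<in> S" "\<And>s. s \<in> S \<Longrightarrow> s0 \<le> s"
      using compact_attains_inf by metis
    have "norm (x s0 - x 0) \<le> M * s0"
    proof (rule step)
      show "norm (x u - x 0) < 1" if "0 < u" "u < s0" for u
        using s0(1) s0(2)[of u] that by (force simp: S_def)
    qed (use s0(1) in \<open>auto simp: S_def\<close>)
    also have "\<dots> \<le> M * t"
      using s0(1) \<open>M > 0\<close> by (simp add: S_def)
    finally show False using t s0(1) by (simp add: S_def)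
  qed
  show ?thesis
    by (rule step) (use t near in auto)
qed

text \<open>Up to time \<open>t\<close> the curve stays within \<open>M * t\<close> of
  \<open>x 0\<close>, so its velocities lie within \<open>\<bar>L\<bar> * (M * t)\<close> of
  \<open>F (x 0)\<close>. Integrating the resulting bound on their inner products with
  \<open>p\<close> makes the error quadratic in \<open>t\<close>.\<close>

lemma trajectory_on_displacement_inner_ge:
  assumes x: "trajectory_on F \<tau> x" and growth: "\<And>z v. v \<in> F z \<Longrightarrow> norm v \<le> \<gamma> * norm z + c"
    and "\<gamma> > 0" "c > 0" and M: "M = \<gamma> * (norm (x 0) + 1) + c"
    and t: "0 \<le> t" "t \<le> \<tau>" "M * t < 1"
    and lip: "\<And>z. z \<in> cball (x 0) 1 \<Longrightarrow>
      F z \<subseteq> {w + (L * norm (x 0 - z)) *\<^sub>R b | w b. w \<in> F (x 0) \<and> b \<in> cball 0 1}"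
    and m: "\<And>v. v \<in> F (x 0) \<Longrightarrow> m \<le> v \<bullet> p"
  shows "(m - \<bar>L\<bar> * (M * t) * norm p) * t \<le> (x t - x 0) \<bullet> p"
proof -
  have ac: "abs_continuous_on {0..\<tau>} x" using x by (simp add: trajectory_on_def)
  obtain N where N: "negligible N"
    and dN: "\<And>t. 0 < t \<Longrightarrow> t < \<tau> \<Longrightarrow> t \<notin> N \<Longrightarrow> \<exists>v\<in>F (x t). (x has_vector_derivative v) (at t)"
    using trajectory_on_derivE[OF x] by blast
  have "M > 0" unfolding M using \<open>\<gamma> > 0\<close> \<open>c > 0\<close> by (intro add_nonneg_pos) auto
  have "(m - \<bar>L\<bar> * (M * t) * norm p) * (t - 0) \<le> (x t - x 0) \<bullet> p"
  proof (rule abs_continuous_on_inner_increment_ge[OF _ \<open>0 \<le> t\<close> N])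
    show "abs_continuous_on {0..t} x"
      using ac t by (auto intro: abs_continuous_on_subset)
    fix u assume u: "0 < u" "u < t" "u \<notin> N"
    then obtain v where v: "v \<in> F (x u)" "(x has_vector_derivative v) (at u)"
      using dN[of u] t by force
    have "M * u \<le> M * t" using u \<open>M > 0\<close> by simp
    moreover have "norm (x u - x 0) \<le> M * u"
      using x growth \<open>\<gamma> > 0\<close> \<open>c > 0\<close> M u t \<open>M * u \<le> M * t\<close>
      by (intro trajectory_on_displacement_le) auto
    ultimately have near: "norm (x 0 - x u) \<le> M * t" by (simp add: norm_minus_commute)
    then have "x u \<in> cball (x 0) 1" using t by (simp add: dist_norm)
    with lip v(1) obtain w b where w: "w \<in> F (x 0)" "norm b \<le> 1"
      "v = w + (L * norm (x 0 - x u)) *\<^sub>R b" by fastforce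
    have "\<bar>(L * norm (x 0 - x u)) *\<^sub>R b \<bullet> p\<bar> \<le> norm ((L * norm (x 0 - x u)) *\<^sub>R b) * norm p"
      by (rule Cauchy_Schwarz_ineq2)
    also have "\<dots> = \<bar>L\<bar> * norm (x 0 - x u) * norm b * norm p"
      by (simp add: abs_mult)
    also have "\<dots> \<le> \<bar>L\<bar> * (M * t) * 1 * norm p"
      using near w(2) \<open>M > 0\<close> t by (intro mult_right_mono mult_mono) auto
    finally have "m - \<bar>L\<bar> * (M * t) * norm p \<le> v \<bullet> p"
      using m[OF w(1)] by (simp add: w(3) inner_add_left abs_le_iff)
    then show "\<exists>v. m - \<bar>L\<bar> * (M * t) * norm p \<le> v \<bullet> p \<and> (x has_vector_derivative v) (at u)"
      using v(2) by blast
  qed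
  then show ?thesis by simp
qed

subsection \<open>Trajectories with prescribed initial velocity\<close>

text \<open>The index is a Borel function of \<open>t\<close> into a discrete space, so composing it
  with any sequence of values stays measurable; boundedness then gives integrability.\<close>

lemma bounded_step_integrable_on:
  fixes f :: "'a \<Rightarrow> 'b::euclidean_space" and Y :: "nat \<Rightarrow> 'a"
  assumes bound: "\<And>z. norm (f z) \<le> M"
  shows "(\<lambda>t. f (Y (nat \<lfloor>t * k\<rfloor>))) integrable_on {a..b::real}"
proof (rule measurable_bounded_by_integrable_imp_integrable[where g = "\<lambda>_. M"])
  have "(\<lambda>t::real. nat \<lfloor>t * k\<rfloor>) \<in> measurable borel (count_space UNIV)" by measurable
  then have "(\<lambda>t::real. f (Y (nat \<lfloor>t * k\<rfloor>))) \<in> borel_measurable borel"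
    by (rule measurable_compose) simp
  then show "(\<lambda>t. f (Y (nat \<lfloor>t * k\<rfloor>))) \<in> borel_measurable (lebesgue_on {a..b})"
    by (simp add: measurable_completion measurable_restrict_space1)
qed (auto simp: bound integrable_const_ivl)

text \<open>By compactness of the Euler approximations.\<close>

lemma Peano_existence:
  fixes f :: "'a::euclidean_space \<Rightarrow> 'a"
  assumes cont: "continuous_on UNIV f" and bound: "\<And>z. norm (f z) \<le> M" and "0 \<le> T"
  obtains y where "y 0 = b" "M-lipschitz_on {0..T} y"
    "\<And>t. t \<in> {0..T} \<Longrightarrow> (y has_vector_derivative f (y t)) (at t within {0..T})"
proof -
  have "M \<ge> 0" using bound[of b] norm_ge_zero order_trans by blast
  \<comment> \<open>\<open>Y n\<close> are the Euler iterates with step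
    \<open>1 / real (Suc n)\<close>, \<open>z n\<close> is their piecewise constant interpolation,
    and \<open>y n\<close> integrates \<open>f\<close> along \<open>z n\<close>, which gives the
    Euler polygon.\<close>
  define Y where "Y n = rec_nat b (\<lambda>_ z. z + (1 / real (Suc n)) *\<^sub>R f z)" for n
  have Y: "Y n 0 = b" "Y n (Suc j) = Y n j + (1 / real (Suc n)) *\<^sub>R f (Y n j)" for n j
    by (simp_all add: Y_def)
  define z where "z n t = Y n (nat \<lfloor>t * real (Suc n)\<rfloor>)" for n t
  define g where "g n t = f (z n t)" for n t
  define y where "y n t = b + integral {0..t} (g n)" for n t
  have int: "g n integrable_on {s..t}" for n s t
    unfolding g_def z_def using bound by (rule bounded_step_integrable_on)
  have diff: "y n t - y n s = integral {s..t} (g n)" if "0 \<le> s" "s \<le> t" for n s t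
    using Henstock_Kurzweil_Integration.integral_combine[OF that int[of n 0 t]]
    by (simp add: y_def algebra_simps)
  have bound_int: "norm (integral {s..t} h) \<le> M * (t - s)"
    if "s \<le> t" "h integrable_on {s..t}" "\<And>u. norm (h u) \<le> M" for h :: "real \<Rightarrow> 'a" and s t
    using has_integral_bound_real[OF \<open>M \<ge> 0\<close> finite.emptyI integrable_integral[OF that(2)]] that(1,3) by auto
  have lip: "M-lipschitz_on {0..T} (y n)" for n
  proof (rule lipschitz_on_leI)
    fix s t assume "s \<in> {0..T}" "t \<in> {0..T}" "s \<le> t"
    then have "norm (y n t - y n s) \<le> M * (t - s)"
      using diff[of s t n] bound_int[OF _ int[of n s t]] bound by (simp add: g_def)
    then show "dist (y n s) (y n t) \<le> M * dist s t"
      using \<open>s \<le> t\<close> by (simp add: dist_norm norm_minus_commute)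
  qed (rule \<open>M \<ge> 0\<close>)
  \<comment> \<open>On a grid cell the integrand is constant except possibly at the right end, where
    the floor jumps; that point is discarded as a spike.\<close>
  have node: "y n (real j / real (Suc n)) = Y n j" for n j
  proof (induction j)
    case 0
    then show ?case by (simp add: y_def Y)
  next
    case (Suc j)
    define u v where "u = real j / real (Suc n)" and "v = real (Suc j) / real (Suc n)"
    have uv: "0 \<le> u" "u \<le> v" "v - u = 1 / real (Suc n)"
      by (auto simp: u_def v_def field_simps)
    have "g n t = f (Y n j)" if "t \<in> {u..v} - {v}" for t
    proof -
      have "real j \<le> t * real (Suc n)" "t * real (Suc n) < real j + 1"
        using that by (auto simp: u_def v_def field_simps)
      then have "\<lfloor>t * real (Suc n)\<rfloor> = int j" by linarith
      then show ?thesis by (simp add: g_def z_def)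
    qed
    then have "integral {u..v} (g n) = integral {u..v} (\<lambda>_. f (Y n j))"
      by (intro integral_spike[of "{v}"]) auto
    then have "y n v = y n u + (v - u) *\<^sub>R f (Y n j)"
      using diff[OF uv(1,2), of n] uv by (simp add: algebra_simps)
    then show ?case using Suc.IH uv(3) by (simp add: Y(2) u_def v_def)
  qed
  \<comment> \<open>\<open>z n t\<close> is the value of the polygon at the last grid point not
    after \<open>t\<close>, so the Lipschitz bound applies over at most one step.\<close>
  have near: "norm (z n t - y n t) \<le> M * (1 / real (Suc n))" if t: "t \<in> {0..T}" for n t
  proof -
    define j where "j = nat \<lfloor>t * real (Suc n)\<rfloor>"
    define u where "u = real j / real (Suc n)"
    have "0 \<le> t * real (Suc n)" using t by simp
    then have "real j \<le> t * real (Suc n)" "t * real (Suc n) < real j + 1"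
      unfolding j_def by linarith+
    then have "t * real (Suc n) - real j \<le> 1" "u \<le> t"
      by (auto simp: u_def field_simps)
    moreover have "t - u = (t * real (Suc n) - real j) / real (Suc n)"
      by (simp add: u_def diff_divide_distrib)
    ultimately have u: "0 \<le> u" "u \<le> t" "t - u \<le> 1 / real (Suc n)"
      by (auto simp: u_def intro: divide_right_mono)
    have "z n t = y n u" using node[of n j] by (simp add: z_def j_def u_def)
    then have "norm (z n t - y n t) \<le> M * (t - u)"
      using lipschitz_onD[OF lip[of n], of u t] t u by (simp add: dist_norm)
    also have "\<dots> \<le> M * (1 / real (Suc n))" using u \<open>M \<ge> 0\<close> by (intro mult_left_mono)
    finally show ?thesis .
  qed
  \<comment> \<open>The common Lipschitz constant gives both uniform boundedness and equicontinuity;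
    \<open>M + 1\<close> in the modulus avoids division by zero.\<close>
  obtain x k where x: "continuous_on {0..T} x" and k: "strict_mono (k :: nat \<Rightarrow> nat)"
    and unif: "\<And>e. 0 < e \<Longrightarrow> \<exists>N. \<forall>n t. n \<ge> N \<and> t \<in> {0..T} \<longrightarrow> norm (y (k n) t - x t) < e"
  proof (rule Arzela_Ascoli[of "{0..T}" y "norm b + M * T"])
    fix n t assume t: "t \<in> {0..T}"
    have "norm (y n t) \<le> norm (y n 0) + norm (y n t - y n 0)"
      by (metis add.commute diff_add_cancel norm_triangle_ineq)
    also have "norm (y n t - y n 0) \<le> M * t"
      using lipschitz_onD[OF lip[of n], of t 0] t by (simp add: dist_norm)
    also have "\<dots> \<le> M * T" using t \<open>M \<ge> 0\<close> by (simp add: mult_left_mono)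
    finally show "norm (y n t) \<le> norm b + M * T" by (simp add: y_def)
  next
    fix t e :: real assume t: "t \<in> {0..T}" "0 < e"
    have "norm (y n t - y n s) < e" if "s \<in> {0..T}" "norm (t - s) < e / (M + 1)" for n s
    proof -
      have "norm (y n t - y n s) \<le> M * norm (t - s)"
        using lipschitz_onD[OF lip[of n], of t s] t that by (simp add: dist_norm)
      also have "\<dots> \<le> (M + 1) * norm (t - s)" by (simp add: mult_right_mono)
      also have "\<dots> < e" using that \<open>M \<ge> 0\<close> by (simp add: field_simps)
      finally show ?thesis .
    qed
    then show "\<exists>d. 0 < d \<and> (\<forall>n s. s \<in> {0..T} \<and> norm (t - s) < d \<longrightarrow> norm (y n t - y n s) < e)"
      using \<open>0 < e\<close> \<open>M \<ge> 0\<close> by (intro exI[of _ "e / (M + 1)"]) auto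
  qed auto
  have y_lim: "(\<lambda>i. y (k i) t) \<longlonglongrightarrow> x t" if "t \<in> {0..T}" for t
    unfolding LIMSEQ_iff using unif that by blast
  have z_lim: "(\<lambda>i. z (k i) t) \<longlonglongrightarrow> x t" if t: "t \<in> {0..T}" for t
  proof -
    have "(\<lambda>n. M * (1 / real (Suc n))) \<longlonglongrightarrow> M * 0"
      by (rule tendsto_mult[OF tendsto_const LIMSEQ_Suc[OF lim_1_over_n]])
    then have M0: "(\<lambda>n. M * (1 / real (Suc n))) \<longlonglongrightarrow> 0" by simp
    have "(\<lambda>n. z n t - y n t) \<longlonglongrightarrow> 0"
      by (rule Lim_null_comparison[OF always_eventually M0]) (rule allI, rule near[OF t])
    then have "(\<lambda>i. z (k i) t - y (k i) t) \<longlonglongrightarrow> 0"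
      using LIMSEQ_subseq_LIMSEQ[OF _ k, of "\<lambda>n. z n t - y n t" 0] by (simp add: o_def)
    from tendsto_add[OF this y_lim[OF t]] show ?thesis by simp
  qed
  have cf: "continuous_on {0..T} (\<lambda>s. f (x s))"
    by (rule continuous_on_compose2[OF cont x]) simp
  \<comment> \<open>The integral equation passes to the limit by dominated convergence with the
    constant bound \<open>M\<close>; differentiating it solves the differential equation.\<close>
  have x_eq: "x t = b + integral {0..t} (\<lambda>s. f (x s))" if t: "t \<in> {0..T}" for t
  proof -
    have "(\<lambda>i. integral {0..t} (g (k i))) \<longlonglongrightarrow> integral {0..t} (\<lambda>s. f (x s))"
    proof (rule dominated_convergence(2)[where h = "\<lambda>_. M"])
      fix s assume "s \<in> {0..t}"
      then have "(\<lambda>i. z (k i) s) \<longlonglongrightarrow> x s" using z_lim t by auto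
      then show "(\<lambda>i. g (k i) s) \<longlonglongrightarrow> f (x s)"
        unfolding g_def using cont
        by (intro isCont_tendsto_compose[of _ f]) (simp_all add: continuous_on_eq_continuous_at)
    qed (auto simp: int bound g_def integrable_const_ivl)
    then have "(\<lambda>i. y (k i) t) \<longlonglongrightarrow> b + integral {0..t} (\<lambda>s. f (x s))"
      unfolding y_def by (intro tendsto_intros)
    then show ?thesis using y_lim[OF t] LIMSEQ_unique by blast
  qed
  show thesis
  proof (rule that[of x])
    show "x 0 = b" using x_eq[of 0] \<open>0 \<le> T\<close> by simp
    show "M-lipschitz_on {0..T} x"
    proof (rule lipschitz_onI)
      fix s t assume "s \<in> {0..T}" "t \<in> {0..T}"
      then show "dist (x s) (x t) \<le> M * dist s t"
        by (intro Lim_bounded[OF tendsto_dist[OF y_lim y_lim], of s t 0]) (auto intro: lipschitz_onD[OF lip])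
    qed (rule \<open>M \<ge> 0\<close>)
    fix t assume t: "t \<in> {0..T}"
    have "((\<lambda>t. b + integral {0..t} (\<lambda>s. f (x s))) has_vector_derivative 0 + f (x t)) (at t within {0..T})"
      by (intro has_vector_derivative_add has_vector_derivative_const integral_has_vector_derivative[OF cf t])
    then show "(x has_vector_derivative f (x t)) (at t within {0..T})"
      using has_vector_derivative_transform[OF t, of "x"] x_eq by simp
  qed
qed

text \<open>The variational inequality for the projection onto \<open>F x\<close> is tested with a
  point of \<open>F x\<close> close to the projection onto \<open>F y\<close>, and vice versa.
  Adding both bounds shows that the projection is Hoelder continuous with exponent 1/2 on
  \<open>K\<close>.\<close>

lemma continuous_on_closest_point_multi:
  fixes F :: "'a::euclidean_space \<Rightarrow> 'a set"
  assumes F1: "\<And>x. F x \<noteq> {} \<and> compact (F x) \<and> convex (F x)"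
    and lip: "\<And>x y. x \<in> K \<Longrightarrow> y \<in> K \<Longrightarrow>
      F x \<subseteq> {w + (L * norm (y - x)) *\<^sub>R b | w b. w \<in> F y \<and> b \<in> cball 0 1}"
    and B: "\<And>x u. x \<in> K \<Longrightarrow> u \<in> F x \<Longrightarrow> norm u \<le> B"
  shows "continuous_on K (\<lambda>x. closest_point (F x) v)"
proof -
  define f where "f x = closest_point (F x) v" for x
  have cl: "closed (F x)" "convex (F x)" "F x \<noteq> {}" for x
    using F1 compact_imp_closed by auto
  have f_in: "f x \<in> F x" for x
    unfolding f_def using cl by (simp add: closest_point_in_set)
  define C where "C = 2 * (norm v + \<bar>B\<bar>) * \<bar>L\<bar>"
  have "C \<ge> 0" by (simp add: C_def)
  have half: "(v - f x) \<bullet> (f y - f x) \<le> (norm v + \<bar>B\<bar>) * (\<bar>L\<bar> * norm (y - x))"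
    if xy: "x \<in> K" "y \<in> K" for x y
  proof -
    obtain q b where q: "q \<in> F x" "norm b \<le> 1" "f y = q + (L * norm (x - y)) *\<^sub>R b"
      using lip[OF xy(2,1)] f_in[of y] by fastforce
    have "(v - f x) \<bullet> (q - f x) \<le> 0"
      unfolding f_def by (rule closest_point_dot[OF cl(2,1) q(1)])
    then have "(v - f x) \<bullet> (f y - f x) \<le> (v - f x) \<bullet> (f y - q)"
      by (simp add: inner_diff_right)
    also have "\<dots> \<le> norm (v - f x) * norm (f y - q)" by (rule norm_cauchy_schwarz)
    also have "\<dots> \<le> (norm v + \<bar>B\<bar>) * (\<bar>L\<bar> * norm (y - x))"
    proof (rule mult_mono)
      show "norm (v - f x) \<le> norm v + \<bar>B\<bar>"
        using norm_triangle_ineq4[of v "f x"] B[OF xy(1) f_in] by simp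
      show "norm (f y - q) \<le> \<bar>L\<bar> * norm (y - x)"
        using q(2) mult_left_le[of "norm b" "\<bar>L\<bar> * norm (y - x)"]
        by (simp add: q(3) abs_mult norm_minus_commute)
    qed auto
    finally show ?thesis .
  qed
  have holder: "(norm (f x - f y))\<^sup>2 \<le> C * norm (x - y)" if xy: "x \<in> K" "y \<in> K" for x y
  proof -
    \<comment> \<open>This identity splits the squared distance into the two quantities estimated by
      \<open>half\<close>.\<close>
    have "(norm (f x - f y))\<^sup>2 = (v - f x) \<bullet> (f y - f x) + (v - f y) \<bullet> (f x - f y)"
      by (simp add: power2_norm_eq_inner inner_diff_left inner_diff_right inner_commute)
    then show ?thesis
      using half[OF xy] half[OF xy(2,1)] by (simp add: C_def algebra_simps norm_minus_commute)
  qed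
  have "continuous_on K f"
    unfolding continuous_on_iff
  proof (intro ballI allI impI)
    fix x and e :: real assume x: "x \<in> K" "e > 0"
    have "dist (f y) (f x) < e" if y: "y \<in> K" "dist y x < e\<^sup>2 / (C + 1)" for y
    proof -
      have "(norm (f y - f x))\<^sup>2 \<le> C * norm (y - x)" using holder y x by blast
      also have "\<dots> \<le> (C + 1) * norm (y - x)" by (simp add: mult_right_mono)
      also have "\<dots> < e\<^sup>2" using y \<open>C \<ge> 0\<close> by (simp add: dist_norm field_simps)
      finally show ?thesis
        using x(2) by (simp add: dist_norm power2_less_imp_less)
    qed
    then show "\<exists>d>0. \<forall>y\<in>K. dist y x < d \<longrightarrow> dist (f y) (f x) < e"
      using x(2) \<open>C \<ge> 0\<close> by (intro exI[of _ "e\<^sup>2 / (C + 1)"]) auto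
  qed
  then show ?thesis by (simp add: f_def)
qed

text \<open>The metric projection of \<open>v\<close> onto \<open>F x\<close> is a continuous selection, to which Peano's theorem
  applies.\<close>

lemma trajectory_with_initial_velocity:
  fixes F :: "'a::euclidean_space \<Rightarrow> 'a set"
  assumes F1: "\<And>x. F x \<noteq> {} \<and> compact (F x) \<and> convex (F x)"
    and F2: "locally_Lipschitz_multi F" and F3: "linear_growth_multi F"
    and v: "v \<in> F b"
  obtains S y where "S > 0" "y 0 = b" "(y has_vector_derivative v) (at 0 within {0..S})"
    "\<And>s. s \<in> {0..S} \<Longrightarrow> trajectory_on F s y"
proof -
  obtain \<gamma> c where \<gamma>: "\<gamma> > 0" "c > 0" and growth: "\<And>z v. v \<in> F z \<Longrightarrow> norm v \<le> \<gamma> * norm z + c"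
    using F3 unfolding linear_growth_multi_def by blast
  define K where "K = cball b 1"
  have K: "compact K" "closed K" "convex K" "K \<noteq> {}" "b \<in> K" by (auto simp: K_def)
  obtain L where L: "\<And>x y. x \<in> K \<Longrightarrow> y \<in> K \<Longrightarrow>
      F x \<subseteq> {w + (L * norm (y - x)) *\<^sub>R b | w b. w \<in> F y \<and> b \<in> cball 0 1}"
    using F2 K(1) unfolding locally_Lipschitz_multi_def by meson
  define M where "M = \<gamma> * (norm b + 1) + c"
  have "M > 0" unfolding M_def using \<gamma> by (intro add_nonneg_pos) auto
  have M: "norm u \<le> M" if "x \<in> K" "u \<in> F x" for x u
  proof -
    have "norm x \<le> norm b + 1"
      using that(1) norm_triangle_sub[of x b] by (simp add: K_def dist_norm norm_minus_commute)
    then have "\<gamma> * norm x + c \<le> M" using \<gamma> by (simp add: M_def)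
    then show ?thesis using growth[OF that(2)] by simp
  qed
  define f where "f x = closest_point (F x) v" for x
  have f_in: "f x \<in> F x" for x
    unfolding f_def using F1[of x] by (simp add: closest_point_in_set compact_imp_closed)
  have fb: "f b = v" unfolding f_def using v by (rule closest_point_self)
  \<comment> \<open>With speed at most \<open>M\<close>, a curve starting at the centre of
    \<open>K\<close> cannot leave \<open>K\<close> before time \<open>1 / M\<close>.\<close>
  define S where "S = 1 / M"
  have "S > 0" using \<open>M > 0\<close> by (simp add: S_def)
  \<comment> \<open>Composing with the projection onto \<open>K\<close> turns the selection into a
    bounded continuous field on the whole space, as Peano's theorem requires. Since the solution
    stays in \<open>K\<close>, the projection then disappears.\<close>
  obtain y where y: "y 0 = b" "M-lipschitz_on {0..S} y"
    and dy: "\<And>t. t \<in> {0..S} \<Longrightarrow>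
        (y has_vector_derivative f (closest_point K (y t))) (at t within {0..S})"
  proof (rule Peano_existence[where f = "\<lambda>x. f (closest_point K x)" and M = M and T = S and b = b])
    have "continuous_on K f"
      unfolding f_def using F1 L M by (rule continuous_on_closest_point_multi)
    then show "continuous_on UNIV (\<lambda>x. f (closest_point K x))"
      by (rule continuous_on_compose2[OF _ continuous_on_closest_point])
        (use K closest_point_in_set[OF K(2,4)] in auto)
    show "norm (f (closest_point K x)) \<le> M" for x
      using closest_point_in_set[OF K(2,4)] f_in by (rule M)
  qed (use \<open>S > 0\<close> in auto)
  have yK: "closest_point K (y t) = y t" if t: "t \<in> {0..S}" for t
  proof (rule closest_point_self)
    have "dist (y t) (y 0) \<le> M * t"
      using lipschitz_onD[OF y(2), of t 0] t \<open>S > 0\<close> by (simp add: dist_real_def)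
    also have "\<dots> \<le> M * S" using t \<open>M > 0\<close> by simp
    also have "\<dots> = 1" using \<open>M > 0\<close> by (simp add: S_def)
    finally show "y t \<in> K" by (simp add: K_def y(1) dist_commute)
  qed
  show thesis
  proof (rule that[of S y])
    show "S > 0" "y 0 = b" by fact+
    show "(y has_vector_derivative v) (at 0 within {0..S})"
      using dy[of 0] yK[of 0] \<open>S > 0\<close> fb y(1) by simp
    fix s assume s: "s \<in> {0..S}"
    show "trajectory_on F s y"
    proof (rule trajectory_onI[where N = "{}"])
      show "M-lipschitz_on {0..s} y" using y(2) s by (auto intro: lipschitz_on_subset)
      fix t assume t: "0 < t" "t < s"
      then have "(y has_vector_derivative f (y t)) (at t)"
        using dy[of t] yK[of t] s at_within_Icc_at[of 0 t S] by auto
      then show "\<exists>v\<in>F (y t). (y has_vector_derivative v) (at t)" using f_in by blast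
    qed simp
  qed
qed

subsection \<open>Frechet normals to the sublevel sets\<close>

text \<open>Compactness provides a minimiser, so that \<open>LEAST\<close> denotes the actual
  minimum.\<close>

lemma hamiltonian_attained:
  assumes "F x \<noteq> {}" "compact (F x)"
  obtains v where "v \<in> F x" "hamiltonian F x p = v \<bullet> p" "\<And>u. u \<in> F x \<Longrightarrow> hamiltonian F x p \<le> u \<bullet> p"
proof -
  have "continuous_on (F x) (\<lambda>v. v \<bullet> p)" by (intro continuous_intros)
  then obtain v where v: "v \<in> F x" "\<And>u. u \<in> F x \<Longrightarrow> v \<bullet> p \<le> u \<bullet> p"
    using continuous_attains_inf[OF assms(2,1)] by blast
  then have "hamiltonian F x p = v \<bullet> p"
    unfolding hamiltonian_def by (intro Least_equality) auto
  then show thesis using that v by simp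
qed

lemma hamiltonian_uminus: "hamiltonian (\<lambda>z. uminus ` F z) x p = hamiltonian F x (- p)"
  by (simp add: hamiltonian_def image_image)

lemma mem_min_time_sublevelI:
  assumes "trajectory_on F \<tau> x" "0 \<le> \<tau>" "\<tau> \<le> t"
  shows "(x 0, x \<tau>) \<in> min_time_sublevel F t"
proof -
  have "bilateral_min_time F (x 0) (x \<tau>) \<le> ereal \<tau>"
    unfolding bilateral_min_time_def by (rule Inf_lower) (use assms in blast)
  also have "\<dots> \<le> ereal t" using assms(3) by simp
  finally show ?thesis by (simp add: min_time_sublevel_def)
qed

text \<open>Instead of an optimal trajectory, whose existence would require a compactness theorem for the
  inclusion, a trajectory of duration less than \<open>r + \<epsilon> t\<close> is followed from time \<open>t\<close> on. The time
  gained exceeds \<open>(1 - \<epsilon>) t\<close> and is spent moving along \<open>y\<close>.\<close>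

lemma frechet_normal_inner_le:
  fixes F :: "'a::euclidean_space \<Rightarrow> 'a set"
  assumes F2: "locally_Lipschitz_multi F" and F3: "linear_growth_multi F"
    and r: "bilateral_min_time F \<alpha> \<beta> = ereal r" "0 < r"
    and normal: "(\<zeta>, \<theta>) \<in> frechet_normal_cone (min_time_sublevel F r) (\<alpha>, \<beta>)"
    and S: "S > 0" and y0: "y 0 = \<beta>" and dy: "(y has_vector_derivative v) (at 0 within {0..S})"
    and y: "\<And>s. s \<in> {0..S} \<Longrightarrow>
      \<exists>\<sigma> w. 0 \<le> \<sigma> \<and> \<sigma> \<le> s \<and> trajectory_on F \<sigma> w \<and> w 0 = \<beta> \<and> w \<sigma> = y s"
    and m: "\<And>u. u \<in> F \<alpha> \<Longrightarrow> m \<le> u \<bullet> \<zeta>"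
  shows "m + v \<bullet> \<theta> \<le> 0"
proof -
  obtain \<gamma> c where \<gamma>: "\<gamma> > 0" "c > 0" and growth: "\<And>z v. v \<in> F z \<Longrightarrow> norm v \<le> \<gamma> * norm z + c"
    using F3 unfolding linear_growth_multi_def by blast
  have "compact (cball \<alpha> 1)" by simp
  then obtain L where L: "\<forall>x\<in>cball \<alpha> 1. \<forall>y\<in>cball \<alpha> 1.
      F x \<subseteq> {w + (L * norm (y - x)) *\<^sub>R b | w b. w \<in> F y \<and> b \<in> cball 0 1}"
    using F2 unfolding locally_Lipschitz_multi_def by meson
  define M where "M = \<gamma> * (norm \<alpha> + 1) + c"
  have "M > 0" unfolding M_def using \<gamma> by (intro add_nonneg_pos) auto
  \<comment> \<open>\<open>D * t\<close> bounds the displacement of the pair of endpoints: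
    \<open>M * t\<close> for the first, \<open>(norm v + 1) * t\<close> for the second.\<close>
  define D where "D = M + norm v + 1"
  have "D > 0" using \<open>M > 0\<close> by (simp add: D_def add_pos_nonneg)
  \<comment> \<open>The coefficients of \<open>e * t\<close> in the final estimate: \<open>D\<close>
    from normality, \<open>norm \<theta>\<close> from differentiability of \<open>y\<close>, the
    third from \<open>t - s \<le> e * t\<close>, and the last from the variation of \<open>F\<close>
    along \<open>x\<close>, using \<open>t < e\<close>.\<close>
  define C where "C = D + norm \<theta> + \<bar>v \<bullet> \<theta>\<bar> + \<bar>L\<bar> * M * norm \<zeta>"
  have main: "m + v \<bullet> \<theta> \<le> e * C" if e: "0 < e" "e < 1" for e
  proof -
    obtain \<delta> where "\<delta> > 0" and \<delta>: "\<And>z. z \<in> min_time_sublevel F r \<Longrightarrow> norm (z - (\<alpha>, \<beta>)) < \<delta> \<Longrightarrow>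
        (\<zeta>, \<theta>) \<bullet> (z - (\<alpha>, \<beta>)) \<le> e * norm (z - (\<alpha>, \<beta>))"
      using normal e(1) unfolding frechet_normal_cone_def by blast
    obtain s1 where "s1 > 0" and s1: "\<And>s. s \<in> {0..S} \<Longrightarrow> norm (s - 0) < s1 \<Longrightarrow>
        norm (y s - y 0 - (s - 0) *\<^sub>R v) \<le> e * norm (s - 0)"
      using dy e(1) unfolding has_vector_derivative_def has_derivative_within_alt by blast
    \<comment> \<open>Upper limits for \<open>t\<close>: \<open>e\<close> absorbs the quadratic
      error, \<open>r\<close> allows removal of an initial piece, \<open>S\<close> and
      \<open>s1\<close> serve \<open>y\<close>, \<open>1 / M\<close> the displacement estimates, and
      \<open>\<delta> / D\<close> normality. Halving the minimum makes all of them strict.\<close>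
    define A where "A = {e, r, S, s1, 1 / M, \<delta> / D}"
    define t where "t = Min A / 2"
    have "0 < Min A"
      using e r(2) S \<open>s1 > 0\<close> \<open>M > 0\<close> \<open>\<delta> > 0\<close> \<open>D > 0\<close> by (simp add: A_def)
    have "finite A" by (simp add: A_def)
    have tA: "t < a" if "a \<in> A" for a
      using Min_le[OF \<open>finite A\<close> that] \<open>0 < Min A\<close> by (simp add: t_def)
    have t: "0 < t" "t < e" "t < r" "t < S" "t < s1" "t < 1 / M" "t < \<delta> / D"
    proof -
      show "0 < t" using \<open>0 < Min A\<close> by (simp add: t_def)
    qed (rule tA, simp add: A_def)+
    have tM: "M * t < 1" and tD: "D * t < \<delta>"
      using t(6,7) \<open>M > 0\<close> \<open>D > 0\<close> by (simp_all add: field_simps)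
    have "bilateral_min_time F \<alpha> \<beta> < ereal (r + e * t)"
      using r(1) e t(1) by simp
    then obtain \<tau> x where x: "\<tau> < r + e * t" "0 \<le> \<tau>" "trajectory_on F \<tau> x" "x 0 = \<alpha>" "x \<tau> = \<beta>"
      unfolding bilateral_min_time_def Inf_less_iff by auto
    have "ereal r \<le> ereal \<tau>"
      unfolding r(1)[symmetric] bilateral_min_time_def by (rule Inf_lower) (use x in blast)
    then have "r \<le> \<tau>" by simp
    \<comment> \<open>The time \<open>t\<close> saved on \<open>x\<close>, less the excess of its
      duration over \<open>r\<close>. This excess is nonnegative and below
      \<open>e * t\<close>.\<close>
    define s where "s = t - (\<tau> - r)"
    have "e * t \<le> t" using e t(1) by simp
    have s: "0 \<le> s" "s \<le> t" "(1 - e) * t \<le> s"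
      using \<open>r \<le> \<tau>\<close> x(1) \<open>e * t \<le> t\<close> by (auto simp: s_def algebra_simps)
    then obtain \<sigma> w where w: "0 \<le> \<sigma>" "\<sigma> \<le> s" "trajectory_on F \<sigma> w" "w 0 = \<beta>" "w \<sigma> = y s"
      using y[of s] t by force
    have t\<tau>: "0 \<le> t" "t \<le> \<tau>" using t \<open>r \<le> \<tau>\<close> by auto
    \<comment> \<open>Follow \<open>x\<close> from time \<open>t\<close> to \<beta>, then
      \<open>w\<close> to \<open>y s\<close>. The total duration is at most
      \<open>\<tau> - t + s = r\<close>.\<close>
    define X where "X = (\<lambda>u. if u \<le> \<tau> - t then x (u + t) else w (u - (\<tau> - t)))"
    have "trajectory_on F (\<tau> - t + \<sigma>) X"
      unfolding X_def using t\<tau> w x(5)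
      by (intro trajectory_on_concat trajectory_on_shift[OF x(3) F3] F3) auto
    moreover have "X 0 = x t" "X (\<tau> - t + \<sigma>) = y s"
      using t\<tau> w x(5) by (auto simp: X_def)
    moreover have "\<tau> - t + \<sigma> \<le> r" using w(2) by (simp add: s_def)
    ultimately have mem: "(x t, y s) \<in> min_time_sublevel F r"
      using mem_min_time_sublevelI[of F "\<tau> - t + \<sigma>" X r] t\<tau> w(1) by auto
    have x_near: "norm (x t - \<alpha>) \<le> M * t"
      using trajectory_on_displacement_le[OF x(3) growth \<gamma>, of M t] t\<tau> tM
      by (simp add: x(4) M_def)
    have y_near: "norm (y s - \<beta> - s *\<^sub>R v) \<le> e * s"
      using s1[of s] s t y0 by simp
    have "norm (y s - \<beta>) \<le> norm (y s - \<beta> - s *\<^sub>R v) + norm (s *\<^sub>R v)"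
      using norm_triangle_ineq[of "y s - \<beta> - s *\<^sub>R v" "s *\<^sub>R v"] by simp
    also have "\<dots> \<le> 1 * t + t * norm v"
      using y_near mult_mono[of e 1 s t] mult_right_mono[OF s(2), of "norm v"] e s
      by simp
    finally have "norm ((x t, y s) - (\<alpha>, \<beta>)) \<le> D * t"
      using norm_Pair_le[of "x t - \<alpha>" "y s - \<beta>"] x_near by (simp add: D_def algebra_simps)
    moreover from this have "(\<zeta>, \<theta>) \<bullet> ((x t, y s) - (\<alpha>, \<beta>)) \<le> e * norm ((x t, y s) - (\<alpha>, \<beta>))"
      using \<delta>[OF mem] tD by linarith
    ultimately have "(\<zeta>, \<theta>) \<bullet> ((x t, y s) - (\<alpha>, \<beta>)) \<le> e * (D * t)"
      using e by (meson mult_left_mono less_imp_le order_trans)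
    then have up: "(x t - \<alpha>) \<bullet> \<zeta> + (y s - \<beta>) \<bullet> \<theta> \<le> e * D * t"
      by (simp add: inner_commute)
    have lowx: "(m - \<bar>L\<bar> * (M * t) * norm \<zeta>) * t \<le> (x t - \<alpha>) \<bullet> \<zeta>"
      using trajectory_on_displacement_inner_ge[OF x(3) growth \<gamma>, of M t L m \<zeta>] L m t\<tau> tM
      by (simp add: x(4) M_def)
    have "\<bar>(y s - \<beta> - s *\<^sub>R v) \<bullet> \<theta>\<bar> \<le> norm (y s - \<beta> - s *\<^sub>R v) * norm \<theta>"
      by (rule Cauchy_Schwarz_ineq2)
    also have "\<dots> \<le> e * s * norm \<theta>" using y_near by (rule mult_right_mono) simp
    also have "\<dots> \<le> e * t * norm \<theta>" using s e by (intro mult_right_mono mult_left_mono) auto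
    finally have "s * (v \<bullet> \<theta>) - e * t * norm \<theta> \<le> (y s - \<beta>) \<bullet> \<theta>"
      by (simp add: inner_diff_left abs_le_iff)
    moreover have "\<bar>(t - s) * (v \<bullet> \<theta>)\<bar> \<le> (e * t) * \<bar>v \<bullet> \<theta>\<bar>"
      unfolding abs_mult using s by (intro mult_right_mono) (auto simp: algebra_simps)
    ultimately have lowy: "t * (v \<bullet> \<theta>) - e * t * \<bar>v \<bullet> \<theta>\<bar> - e * t * norm \<theta> \<le> (y s - \<beta>) \<bullet> \<theta>"
      by (simp add: algebra_simps abs_le_iff)
    have "\<bar>L\<bar> * M * norm \<zeta> * t \<le> \<bar>L\<bar> * M * norm \<zeta> * e"
      using t \<open>M > 0\<close> by (intro mult_left_mono) auto
    then have "(\<bar>L\<bar> * M * norm \<zeta> * t) * t \<le> (\<bar>L\<bar> * M * norm \<zeta> * e) * t"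
      using t by (intro mult_right_mono) auto
    then have "(m + v \<bullet> \<theta>) * t \<le> (e * C) * t"
      using up lowx lowy by (simp add: C_def algebra_simps)
    then show ?thesis using t(1) by simp
  qed
  show ?thesis
  proof (rule ccontr)
    assume "\<not> m + v \<bullet> \<theta> \<le> 0"
    then have pos: "m + v \<bullet> \<theta> > 0" by simp
    \<comment> \<open>Small enough that \<open>e * C\<close> is at most half of the supposedly
      positive left-hand side, contradicting \<open>main\<close>.\<close>
    define e where "e = min (1/2) ((m + v \<bullet> \<theta>) / (2 * (\<bar>C\<bar> + 1)))"
    have e: "0 < e" "e < 1" using pos by (auto simp: e_def)
    have "e * C \<le> e * (\<bar>C\<bar> + 1)" using e by (intro mult_left_mono) auto
    also have "\<dots> \<le> (m + v \<bullet> \<theta>) / (2 * (\<bar>C\<bar> + 1)) * (\<bar>C\<bar> + 1)"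
      by (intro mult_right_mono) (auto simp: e_def)
    also have "\<dots> = (m + v \<bullet> \<theta>) / 2" by (simp add: field_simps)
    finally show False using main[OF e] pos by simp
  qed
qed

text \<open>Standing still at \<beta> is modelled by a constant \<open>y\<close> with
  \<open>v = 0\<close>. Each of its points is reached by a trajectory of duration 0, even if
  \<open>0\<close> is not in \<open>F \<beta>\<close>; this is why
  \<open>frechet_normal_inner_le\<close> asks only for a duration of at most
  \<open>s\<close>.\<close>

lemma hamiltonian_frechet_normal_nonpos:
  fixes F :: "'a::euclidean_space \<Rightarrow> 'a set"
  assumes F1: "\<And>x. F x \<noteq> {} \<and> compact (F x) \<and> convex (F x)"
    and F2: "locally_Lipschitz_multi F" and F3: "linear_growth_multi F"
    and r: "bilateral_min_time F \<alpha> \<beta> = ereal r" "0 < r"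
    and normal: "(\<zeta>, \<theta>) \<in> frechet_normal_cone (min_time_sublevel F r) (\<alpha>, \<beta>)"
  shows "hamiltonian F \<alpha> \<zeta> \<le> 0"
proof -
  have "hamiltonian F \<alpha> \<zeta> + 0 \<bullet> \<theta> \<le> 0"
  proof (rule frechet_normal_inner_le[OF F2 F3 r normal, of 1 "\<lambda>_. \<beta>"])
    show "\<exists>\<sigma> w. 0 \<le> \<sigma> \<and> \<sigma> \<le> s \<and> trajectory_on F \<sigma> w \<and> w 0 = \<beta> \<and> w \<sigma> = \<beta>"
      if "s \<in> {0..1}" for s :: real
      using that trajectory_on_zero by (intro exI[of _ 0] exI[of _ "\<lambda>_. \<beta>"]) auto
    show "hamiltonian F \<alpha> \<zeta> \<le> u \<bullet> \<zeta>" if "u \<in> F \<alpha>" for u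
      using hamiltonian_attained[of F \<alpha> \<zeta>] F1 that by metis
  qed auto
  then show ?thesis by simp
qed

lemma hamiltonian_frechet_normal_le:
  fixes F :: "'a::euclidean_space \<Rightarrow> 'a set"
  assumes F1: "\<And>x. F x \<noteq> {} \<and> compact (F x) \<and> convex (F x)"
    and F2: "locally_Lipschitz_multi F" and F3: "linear_growth_multi F"
    and r: "bilateral_min_time F \<alpha> \<beta> = ereal r" "0 < r"
    and normal: "(\<zeta>, \<theta>) \<in> frechet_normal_cone (min_time_sublevel F r) (\<alpha>, \<beta>)"
  shows "hamiltonian F \<alpha> \<zeta> \<le> hamiltonian F \<beta> (- \<theta>)"
proof -
  \<comment> \<open>A minimiser for \<open>- \<theta>\<close> maximises the inner product with
    \<theta>, so it gives the strongest of the available inequalities.\<close>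
  obtain v where v: "v \<in> F \<beta>" "hamiltonian F \<beta> (- \<theta>) = v \<bullet> (- \<theta>)"
    using hamiltonian_attained[of F \<beta> "- \<theta>"] F1 by metis
  obtain S y where y: "S > 0" "y 0 = \<beta>" "(y has_vector_derivative v) (at 0 within {0..S})"
    "\<And>s. s \<in> {0..S} \<Longrightarrow> trajectory_on F s y"
    using trajectory_with_initial_velocity[OF F1 F2 F3 v(1)] by blast
  have "hamiltonian F \<alpha> \<zeta> + v \<bullet> \<theta> \<le> 0"
  proof (rule frechet_normal_inner_le[OF F2 F3 r normal y(1-3)])
    show "\<exists>\<sigma> w. 0 \<le> \<sigma> \<and> \<sigma> \<le> s \<and> trajectory_on F \<sigma> w \<and> w 0 = \<beta> \<and> w \<sigma> = y s"
      if "s \<in> {0..S}" for s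
      using that y(2) y(4)[OF that] by (intro exI[of _ s] exI[of _ y]) auto
    show "hamiltonian F \<alpha> \<zeta> \<le> u \<bullet> \<zeta>" if "u \<in> F \<alpha>" for u
      using hamiltonian_attained[of F \<alpha> \<zeta>] F1 that by metis
  qed
  then show ?thesis using v(2) by simp
qed

section \<open>Invariance under time reversal\<close>

lemma linear_growth_multi_uminus:
  "linear_growth_multi F \<Longrightarrow> linear_growth_multi (\<lambda>z. uminus ` F z)"
  unfolding linear_growth_multi_def by simp

lemma locally_Lipschitz_multi_uminus:
  assumes "locally_Lipschitz_multi F"
  shows "locally_Lipschitz_multi (\<lambda>z. uminus ` F z)"
  unfolding locally_Lipschitz_multi_def
proof (intro allI impI)
  fix K :: "'a set" assume "compact K"
  then obtain L where L: "\<forall>x\<in>K. \<forall>y\<in>K.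
      F x \<subseteq> {w + (L * norm (y - x)) *\<^sub>R b | w b. w \<in> F y \<and> b \<in> cball 0 1}"
    using assms unfolding locally_Lipschitz_multi_def by meson
  show "\<exists>L. \<forall>x\<in>K. \<forall>y\<in>K. uminus ` F x \<subseteq>
      {w + (L * norm (y - x)) *\<^sub>R b | w b. w \<in> uminus ` F y \<and> b \<in> cball 0 1}"
  proof (intro exI[of _ L] ballI subsetI)
    fix x y u assume xy: "x \<in> K" "y \<in> K" and "u \<in> uminus ` F x"
    then have "- u \<in> F x" by auto
    with L xy obtain w b where "w \<in> F y" "norm b \<le> 1" "- u = w + (L * norm (y - x)) *\<^sub>R b"
      by fastforce
    moreover from this(3) have "u = - (w + (L * norm (y - x)) *\<^sub>R b)" by (metis minus_minus)
    ultimately have "- w \<in> uminus ` F y" "- b \<in> cball 0 1" "u = - w + (L * norm (y - x)) *\<^sub>R (- b)"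
      by auto
    then show "u \<in> {w + (L * norm (y - x)) *\<^sub>R b | w b. w \<in> uminus ` F y \<and> b \<in> cball 0 1}"
      by blast
  qed
qed

text \<open>Both infima range over the same durations: reversal maps trajectories of
  \<open>F\<close> to those of \<open>-F\<close> with endpoints exchanged, and reversing once more
  returns to \<open>F\<close>.\<close>

lemma bilateral_min_time_uminus:
  assumes "linear_growth_multi F"
  shows "bilateral_min_time (\<lambda>z. uminus ` F z) \<beta> \<alpha> = bilateral_min_time F \<alpha> \<beta>"
proof -
  have rev: "\<exists>x. trajectory_on (\<lambda>z. uminus ` G z) \<tau> x \<and> x 0 = b \<and> x \<tau> = a"
    if "linear_growth_multi G" "\<exists>x. trajectory_on G \<tau> x \<and> x 0 = a \<and> x \<tau> = b"
    for G :: "'a \<Rightarrow> 'a set" and \<tau> a b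
    using trajectory_on_reverse that by fastforce
  have F_eq: "(\<lambda>z. uminus ` uminus ` F z) = F" by (simp add: image_image)
  have "(\<exists>x. trajectory_on (\<lambda>z. uminus ` F z) \<tau> x \<and> x 0 = \<beta> \<and> x \<tau> = \<alpha>) \<longleftrightarrow>
      (\<exists>x. trajectory_on F \<tau> x \<and> x 0 = \<alpha> \<and> x \<tau> = \<beta>)" for \<tau>
    using rev[OF assms, of \<tau> \<alpha> \<beta>] rev[OF linear_growth_multi_uminus[OF assms], of \<tau> \<beta> \<alpha>]
    unfolding F_eq by (rule iffI[rotated])
  then show ?thesis by (simp add: bilateral_min_time_def)
qed

text \<open>Exchanging the factors of the product space is a linear isometry.\<close>

lemma frechet_normal_cone_swap:
  assumes "(\<zeta>, \<theta>) \<in> frechet_normal_cone R (\<alpha>, \<beta>)"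
  shows "(\<theta>, \<zeta>) \<in> frechet_normal_cone (prod.swap ` R) (\<beta>, \<alpha>)"
proof -
  have swap: "(\<theta>, \<zeta>) \<bullet> (prod.swap z - (\<beta>, \<alpha>)) = (\<zeta>, \<theta>) \<bullet> (z - (\<alpha>, \<beta>))"
    "norm (prod.swap z - (\<beta>, \<alpha>)) = norm (z - (\<alpha>, \<beta>))" for z
    by (cases z; simp add: norm_Pair add.commute)+
  show ?thesis
    using assms unfolding frechet_normal_cone_def by (simp add: swap)
qed

theorem proposition3p2:
  fixes F :: "real ^ 'n \<Rightarrow> (real ^ 'n) set"
    and \<alpha> \<beta> \<zeta> \<theta> :: "real ^ 'n"
    and r :: real
  assumes F1: "\<And>x. F x \<noteq> {} \<and> compact (F x) \<and> convex (F x)"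
    and F2: "locally_Lipschitz_multi F"
    and F3: "linear_growth_multi F"
    and r: "bilateral_min_time F \<alpha> \<beta> = ereal r" "0 < r"
    and normal: "(\<zeta>, \<theta>) \<in> frechet_normal_cone (min_time_sublevel F r) (\<alpha>, \<beta>)"
  shows "hamiltonian F \<alpha> \<zeta> = hamiltonian F \<beta> (- \<theta>) \<and> hamiltonian F \<beta> (- \<theta>) \<le> 0"
proof -
  let ?G = "\<lambda>z. uminus ` F z"
  have "min_time_sublevel ?G r = prod.swap ` min_time_sublevel F r"
    by (force simp: min_time_sublevel_def bilateral_min_time_uminus[OF F3])
  then have G_normal: "(\<theta>, \<zeta>) \<in> frechet_normal_cone (min_time_sublevel ?G r) (\<beta>, \<alpha>)"
    using frechet_normal_cone_swap[OF normal] by simp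
  \<comment> \<open>The one-sided inequality for \<open>-F\<close> from \<beta> to \<alpha> with
    normal \<open>(\<theta>, \<zeta>)\<close>; rewriting both Hamiltonians in terms of
    \<open>F\<close> gives the missing direction.\<close>
  have "hamiltonian ?G \<beta> \<theta> \<le> hamiltonian ?G \<alpha> (- \<zeta>)"
  proof (rule hamiltonian_frechet_normal_le[OF _ _ _ _ r(2) G_normal])
    show "?G x \<noteq> {} \<and> compact (?G x) \<and> convex (?G x)" for x
      using F1[of x] by (auto intro: compact_negations convex_negations)
    show "bilateral_min_time ?G \<beta> \<alpha> = ereal r"
      using bilateral_min_time_uminus[OF F3] r(1) by simp
  qed (use F2 F3 locally_Lipschitz_multi_uminus linear_growth_multi_uminus in blast)+
  then have "hamiltonian F \<beta> (- \<theta>) \<le> hamiltonian F \<alpha> \<zeta>"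
    by (simp add: hamiltonian_uminus)
  moreover have "hamiltonian F \<alpha> \<zeta> \<le> hamiltonian F \<beta> (- \<theta>)"
    using F1 F2 F3 r normal by (rule hamiltonian_frechet_normal_le)
  moreover have "hamiltonian F \<alpha> \<zeta> \<le> 0"
    using F1 F2 F3 r normal by (rule hamiltonian_frechet_normal_nonpos)
  ultimately show ?thesis by simp
qed

end
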